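(* Let $\{\xi_i\}_{i\ge1}$ be i.i.d. real random variables with $\xi_i=x^*+e_i$, where $x^*=0$ and the $e_i$ are i.i.d. Gaussian with $\mathbb{E}e_i=0$ and $\mathbb{E}e_i^2=\sigma<\infty$. Let $x_0=0$ and, for $i\ge1$, $x_i=x_{i-1}-\eta_i(x_{i-1}-\xi_i)$ with $\eta_i=\eta i^{-\alpha}$, $\eta>0$, $\alpha\in(1/2,1)$. Let $$\hat\sigma_n=\frac1n\sum_{i=1}^n\Big[2x_i\Big(\sum_{k=i-\ell_i+1}^{i}x_k\Big)-x_i^2\Big]$$ with batch sizes $\ell_i=C_\eta i^{\alpha}\log i$ for a constant $C_\eta>\eta^{-1}$. Then $$\mathbb{E}(\hat\sigma_n-\sigma)^2\asymp n^{-1+\alpha}\log n.$$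
   Context: $a_n\asymp b_n$ means there are constants $0<c\le C<\infty$ independent of $n$ with $cb_n\le a_n\le Cb_n$ for all $n$. Here $\sigma$ is the noise variance, which equals the limiting variance of $\sqrt n\,\bar x_n$, $\bar x_n=n^{-1}\sum_{i=1}^n x_i$.
   Formalization: The two-sided bound is stated for n ≥ 2 (at n = 1 the right side is log 1 = 0 while the error is positive) and for σ > 0 (for σ = 0 the error is identically 0); batch sizes are rounded down and the inner sum is restricted to k ≥ 1. *)

theory Defs
  imports "HOL-Probability.Probability"
begin

primrec sgd_iter :: "real \<Rightarrow> real \<Rightarrow> (nat \<Rightarrow> real) \<Rightarrow> nat \<Rightarrow> real" where
  "sgd_iter eta alpha xi 0 = 0"
| "sgd_iter eta alpha xi (Suc i) =
     sgd_iter eta alpha xi i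
       - eta * real (Suc i) powr (- alpha) * (sgd_iter eta alpha xi i - xi (Suc i))"

definition batch_len :: "real \<Rightarrow> real \<Rightarrow> nat \<Rightarrow> nat" where
  "batch_len Ceta alpha i = nat \<lfloor>Ceta * real i powr alpha * ln (real i)\<rfloor>"

text \<open>Batch-means variance estimator; the inner sum runs over
  k = i - l_i + 1 .. i, restricted to k >= 1 (x_0 = 0 anyway).\<close>
definition sigma_hat :: "real \<Rightarrow> real \<Rightarrow> real \<Rightarrow> (nat \<Rightarrow> real) \<Rightarrow> nat \<Rightarrow> real" where
  "sigma_hat eta alpha Ceta xi n =
     (1 / real n) * (\<Sum>i=1..n.
        2 * sgd_iter eta alpha xi i
            * (\<Sum>k\<in>{k. 1 \<le> k \<and> k \<le> i \<and> i < k + batch_len Ceta alpha i}. sgd_iter eta alpha xi k)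
        - (sgd_iter eta alpha xi i)\<^sup>2)"

end

theory Submission
  imports Defs "HOL-Real_Asymp.Real_Asymp"
begin

text \<open>
  The iterates are linear in the noise, $x_i = \sum_{p \le i} X_{ip} e_p$, so the estimator is a
  Gaussian quadratic form $e^T A e$ with $A = n^{-1} X^T W X$, where $W$ carries the batch weights.
  Fourth moments give
  $\mathrm{E}(e^T A e - \sigma)^2 = \sigma^2 ((\mathrm{tr} A - 1)^2 + \|A + A^T\|_F^2 / 2)$.
  The row and column sums of $|X|$ are bounded, so by Schur's test $\|A\|_F$ is at most a constant times
  $\|W\|_F / n$, and $\|W\|_F^2$ is of order $\sum_i \ell_i$, that is $n^{1+\alpha} \log n$.
  Conversely, apart from finitely many rows and columns $A$ is nonnegative, and its entries are at
  least $c/n$ on a band of width of order $n^\alpha \log n$.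
  For the bias, $v_i = \mathrm{Var}(x_i)/\sigma$ and $S_i = \sum_{k \le i} \mathrm{Cov}(x_i,x_k)/\sigma$
  satisfy relaxation recursions with factor $1 - \eta_i$, which yield $v_i \approx \eta_i / 2$ and
  $S_i = 1/2 + O(i^{-(1-\alpha)/2})$; truncating $S_i$ to the batch costs only $O(1/i)$ because
  $C_\eta \eta > 1$. Hence $(\mathrm{tr} A - 1)^2 = O(n^{\alpha-1})$.
\<close>

subsection \<open>Mean squared error of a Gaussian quadratic form\<close>

lemma (in prob_space) centered_normal_moments:
  fixes X :: "'a \<Rightarrow> real"
  assumes D: "distributed M lborel X (normal_density 0 s)" and s: "s > 0"
  shows "integrable M (\<lambda>\<omega>. X \<omega> ^ k)"
    and "expectation (\<lambda>\<omega>. X \<omega> ^ (2 * j)) = fact (2 * j) / ((2 / s\<^sup>2) ^ j * fact j)"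
    and "odd k \<Longrightarrow> expectation (\<lambda>\<omega>. X \<omega> ^ k) = 0"
proof -
  have "integrable lborel (\<lambda>x. normal_density 0 s x * x ^ k)"
    using integrable_normal_moment[OF s, of 0 k] by simp
  then show "integrable M (\<lambda>\<omega>. X \<omega> ^ k)"
    using distributed_integrable[OF D, of "\<lambda>x. x ^ k"] by simp
  show "expectation (\<lambda>\<omega>. X \<omega> ^ (2 * j)) = fact (2 * j) / ((2 / s\<^sup>2) ^ j * fact j)"
    using distributed_integral[OF D, of "\<lambda>x. x ^ (2 * j)"] integral_normal_moment_even[OF s, of 0 j]
    by simp
  show "expectation (\<lambda>\<omega>. X \<omega> ^ k) = 0" if "odd k"
    using distributed_integral[OF D, of "\<lambda>x. x ^ k"] integral_normal_moment_odd[OF s, of 0] that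
    by (auto elim!: oddE)
qed

text \<open>Isserlis' formula: each of the three pairings of the four factors contributes
  \<open>s ^ 4\<close> when both of its pairs match. If all four indices coincide, all three
  contribute, which is the Gaussian fourth moment \<open>3 * s ^ 4\<close>.\<close>

lemma (in prob_space) indep_normal_fourth_moment:
  fixes e :: "'i \<Rightarrow> 'a \<Rightarrow> real"
  assumes ind: "indep_vars (\<lambda>_. borel) e I" and s: "s > 0"
    and D: "\<And>i. i \<in> I \<Longrightarrow> distributed M lborel (e i) (normal_density 0 s)"
    and I: "p \<in> I" "q \<in> I" "r \<in> I" "t \<in> I"
  shows "integrable M (\<lambda>\<omega>. e p \<omega> * e q \<omega> * (e r \<omega> * e t \<omega>))"
    and "expectation (\<lambda>\<omega>. e p \<omega> * e q \<omega> * (e r \<omega> * e t \<omega>)) =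
      s ^ 4 * (of_bool (p = q \<and> r = t) + of_bool (p = r \<and> q = t) + of_bool (p = t \<and> q = r))"
proof -
  \<comment> \<open>Multiplicity of \<open>i\<close> among the four indices: collecting equal
    factors turns the product into one over distinct indices, to which independence applies.\<close>
  define c :: "'i \<Rightarrow> nat" where "c i = of_bool (i = p) + of_bool (i = q) + of_bool (i = r) + of_bool (i = t)" for i
  define J where "J = {p, q, r, t}"
  have J: "finite J" "J \<subseteq> I"
    using I by (auto simp: J_def)
  have single: "e x \<omega> = (\<Prod>i\<in>J. e i \<omega> ^ of_bool (i = x))" if "x \<in> J" for x \<omega>
  proof -
    have "(\<Prod>i\<in>J. e i \<omega> ^ of_bool (i = x)) = (\<Prod>i\<in>J. if i = x then e i \<omega> else 1)"
      by (intro prod.cong) auto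
    also have "\<dots> = e x \<omega>"
      using that J by simp
    finally show ?thesis by simp
  qed
  have eq: "e p \<omega> * e q \<omega> * (e r \<omega> * e t \<omega>) = (\<Prod>i\<in>J. e i \<omega> ^ c i)" for \<omega>
    using single[of p \<omega>] single[of q \<omega>] single[of r \<omega>] single[of t \<omega>]
    by (simp add: J_def c_def power_add prod.distrib[symmetric] mult.assoc)
  have ind': "indep_vars (\<lambda>_. borel) (\<lambda>i \<omega>. e i \<omega> ^ c i) J"
    by (rule indep_vars_compose2[OF indep_vars_subset[OF ind \<open>J \<subseteq> I\<close>]]) simp
  have int: "integrable M (\<lambda>\<omega>. e i \<omega> ^ c i)" if "i \<in> J" for i
    by (rule centered_normal_moments(1)[OF D s]) (use that J in auto)
  show "integrable M (\<lambda>\<omega>. e p \<omega> * e q \<omega> * (e r \<omega> * e t \<omega>))"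
    unfolding eq using J(1) ind' int by (rule indep_vars_integrable)
  have E: "expectation (\<lambda>\<omega>. e p \<omega> * e q \<omega> * (e r \<omega> * e t \<omega>)) = (\<Prod>i\<in>J. expectation (\<lambda>\<omega>. e i \<omega> ^ c i))"
    unfolding eq using J(1) ind' int by (rule indep_vars_lebesgue_integral)
  have m1: "expectation (e i) = 0" "expectation (\<lambda>\<omega>. e i \<omega> ^ 3) = 0"
       "expectation (\<lambda>\<omega>. (e i \<omega>)\<^sup>2) = s\<^sup>2" "expectation (\<lambda>\<omega>. e i \<omega> ^ 4) = 3 * s ^ 4" if "i \<in> J" for i
  proof -
    have Di: "distributed M lborel (e i) (normal_density 0 s)" using that J D by auto
    show "expectation (e i) = 0" "expectation (\<lambda>\<omega>. e i \<omega> ^ 3) = 0"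
      using centered_normal_moments(3)[OF Di s, of 1] centered_normal_moments(3)[OF Di s, of 3] by auto
    show "expectation (\<lambda>\<omega>. (e i \<omega>)\<^sup>2) = s\<^sup>2"
      using centered_normal_moments(2)[OF Di s, of 1] s by (simp add: fact_numeral)
    show "expectation (\<lambda>\<omega>. e i \<omega> ^ 4) = 3 * s ^ 4"
      using centered_normal_moments(2)[OF Di s, of 2] s
      by (simp add: fact_numeral field_simps power2_eq_square power4_eq_xxxx)
  qed
  define f :: "nat \<Rightarrow> real" where "f k = (if k = 0 then 1 else if k = 2 then s\<^sup>2 else if k = 4 then 3 * s ^ 4 else 0)" for k
  have m: "expectation (\<lambda>\<omega>. e i \<omega> ^ c i) = f (c i)" if "i \<in> J" for i
  proof -
    have "c i \<le> 4" by (auto simp: c_def of_bool_def)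
    then have "c i = 0 \<or> c i = 1 \<or> c i = 2 \<or> c i = 3 \<or> c i = 4" by linarith
    then show ?thesis using m1[OF that] by (auto simp: prob_space f_def)
  qed
  have "(\<Prod>i\<in>J. expectation (\<lambda>\<omega>. e i \<omega> ^ c i)) = (\<Prod>i\<in>J. f (c i))"
    using m by (rule prod.cong[OF refl])
  also have "\<dots> = s ^ 4 * (of_bool (p = q \<and> r = t) + of_bool (p = r \<and> q = t) + of_bool (p = t \<and> q = r))"
    unfolding J_def
    by (cases "p = q"; cases "p = r"; cases "p = t"; cases "q = r"; cases "q = t"; cases "r = t")
       (auto simp: c_def f_def insert_absorb simp flip: power_add)
  finally show "expectation (\<lambda>\<omega>. e p \<omega> * e q \<omega> * (e r \<omega> * e t \<omega>)) =
      s ^ 4 * (of_bool (p = q \<and> r = t) + of_bool (p = r \<and> q = t) + of_bool (p = t \<and> q = r))"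
    unfolding E .
qed

text \<open>The square of the form expands into fourth-order products. The three pairings give the
  squared trace, the squared Frobenius norm and the sum of \<open>A p q * A q p\<close>; the last
  two combine to half the squared Frobenius norm of the matrix plus its transpose.\<close>

lemma (in prob_space) gaussian_quadratic_form_mse:
  fixes e :: "'i \<Rightarrow> 'a \<Rightarrow> real"
  assumes ind: "indep_vars (\<lambda>_. borel) e I" and s: "s > 0"
    and D: "\<And>i. i \<in> I \<Longrightarrow> distributed M lborel (e i) (normal_density 0 s)"
    and J: "finite J" "J \<subseteq> I"
  shows "expectation (\<lambda>\<omega>. ((\<Sum>p\<in>J. \<Sum>q\<in>J. A p q * (e p \<omega> * e q \<omega>)) - s\<^sup>2)\<^sup>2) =
     s ^ 4 * (((\<Sum>p\<in>J. A p p) - 1)\<^sup>2 + (\<Sum>p\<in>J. \<Sum>q\<in>J. (A p q + A q p)\<^sup>2) / 2)"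
proof -
  define Q where "Q \<omega> = (\<Sum>p\<in>J. \<Sum>q\<in>J. A p q * (e p \<omega> * e q \<omega>))" for \<omega>
  note fm = indep_normal_fourth_moment[OF ind s D]
  have JI: "x \<in> I" if "x \<in> J" for x using J that by auto
  have meas[measurable]: "e x \<in> borel_measurable M" if "x \<in> J" for x
    using ind JI[OF that] unfolding indep_vars_def by auto
  have int4: "integrable M (\<lambda>\<omega>. e p \<omega> * e q \<omega> * (e r \<omega> * e t \<omega>))"
    if "p \<in> J" "q \<in> J" "r \<in> J" "t \<in> J" for p q r t
    by (rule fm(1)) (use that JI in auto)
  have int2: "integrable M (\<lambda>\<omega>. e p \<omega> * e q \<omega>)" if "p \<in> J" "q \<in> J" for p q
    by (rule square_integrable_imp_integrable)
       (use that int4[of p q p q] in \<open>auto simp: power2_eq_square\<close>)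
  have h2: "has_bochner_integral M (\<lambda>\<omega>. e p \<omega> * e q \<omega>) (s\<^sup>2 * of_bool (p = q))" if "p \<in> J" "q \<in> J" for p q
  proof (cases "p = q")
    case True
    have "expectation (\<lambda>\<omega>. e p \<omega> ^ (2 * 1)) = s\<^sup>2"
      by (subst centered_normal_moments(2)[OF D s]) (use that JI s in \<open>auto simp: fact_numeral\<close>)
    then show ?thesis using True int2[OF that] by (simp add: power2_eq_square has_bochner_integral_iff)
  next
    case False
    have "indep_vars (\<lambda>_. borel) e {p, q}"
      by (rule indep_vars_subset[OF ind]) (use that JI in auto)
    moreover have "integrable M (e i)" "expectation (e i) = 0" if "i \<in> {p, q}" for i
      using centered_normal_moments(1)[OF D s, of i 1] centered_normal_moments(3)[OF D s, of i 1]
        that \<open>p \<in> J\<close> \<open>q \<in> J\<close> JI by auto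
    ultimately show ?thesis
      using indep_vars_lebesgue_integral[of "{p,q}" e] False int2[OF that] by (auto simp: has_bochner_integral_iff)
  qed
  have h4: "has_bochner_integral M (\<lambda>\<omega>. e p \<omega> * e q \<omega> * (e r \<omega> * e t \<omega>))
      (s ^ 4 * (of_bool (p = q \<and> r = t) + of_bool (p = r \<and> q = t) + of_bool (p = t \<and> q = r)))"
    if "p \<in> J" "q \<in> J" "r \<in> J" "t \<in> J" for p q r t
    unfolding has_bochner_integral_iff using that JI by (intro conjI fm) auto
  have Q2: "(Q \<omega>)\<^sup>2 = (\<Sum>p\<in>J. \<Sum>q\<in>J. \<Sum>r\<in>J. \<Sum>t\<in>J. A p q * A r t * (e p \<omega> * e q \<omega> * (e r \<omega> * e t \<omega>)))" for \<omega>
    unfolding Q_def power2_eq_square sum_distrib_right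
    unfolding sum_distrib_left by (intro sum.cong refl) (simp add: mult_ac)
  define T where "T = (\<Sum>p\<in>J. A p p)"
  have "has_bochner_integral M Q (\<Sum>p\<in>J. \<Sum>q\<in>J. A p q * (s\<^sup>2 * of_bool (p = q)))"
    unfolding Q_def by (intro has_bochner_integral_sum has_bochner_integral_mult_right h2)
  moreover have "(\<Sum>p\<in>J. \<Sum>q\<in>J. A p q * (s\<^sup>2 * of_bool (p = q))) = (\<Sum>p\<in>J. \<Sum>q\<in>J. if p = q then s\<^sup>2 * A p p else 0)"
    by (intro sum.cong) auto
  moreover have "\<dots> = s\<^sup>2 * T"
    using J(1) by (simp add: T_def sum_distrib_left)
  ultimately have iQ: "integrable M Q" and EQ: "expectation Q = s\<^sup>2 * T"
    by (auto simp: has_bochner_integral_iff)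
  have hQ2: "has_bochner_integral M (\<lambda>\<omega>. (Q \<omega>)\<^sup>2) (\<Sum>p\<in>J. \<Sum>q\<in>J. \<Sum>r\<in>J. \<Sum>t\<in>J. A p q * A r t *
        (s ^ 4 * (of_bool (p = q \<and> r = t) + of_bool (p = r \<and> q = t) + of_bool (p = t \<and> q = r))))"
    unfolding Q2 by (intro has_bochner_integral_sum has_bochner_integral_mult_right h4)
  then have iQ2: "integrable M (\<lambda>\<omega>. (Q \<omega>)\<^sup>2)"
    by (auto simp: has_bochner_integral_iff)
  have EQ2: "expectation (\<lambda>\<omega>. (Q \<omega>)\<^sup>2) = s ^ 4 * (T\<^sup>2 + (\<Sum>p\<in>J. \<Sum>q\<in>J. (A p q + A q p)\<^sup>2) / 2)"
  proof -
    have "expectation (\<lambda>\<omega>. (Q \<omega>)\<^sup>2) = (\<Sum>p\<in>J. \<Sum>q\<in>J. \<Sum>r\<in>J. \<Sum>t\<in>J. A p q * A r t *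
        (s ^ 4 * (of_bool (p = q \<and> r = t) + of_bool (p = r \<and> q = t) + of_bool (p = t \<and> q = r))))"
      using hQ2 by (auto simp: has_bochner_integral_iff)
    \<comment> \<open>One fourfold sum per pairing, with the Kronecker deltas written as nested
      conditionals so that the inner sums collapse.\<close>
    also have "\<dots> = s ^ 4 * ((\<Sum>p\<in>J. \<Sum>q\<in>J. \<Sum>r\<in>J. \<Sum>t\<in>J. if t = r then (if q = p then A p p else 0) * A r r else 0)
        + (\<Sum>p\<in>J. \<Sum>q\<in>J. \<Sum>r\<in>J. \<Sum>t\<in>J. if t = q then (if r = p then A p q * A p q else 0) else 0)
        + (\<Sum>p\<in>J. \<Sum>q\<in>J. \<Sum>r\<in>J. \<Sum>t\<in>J. if t = p then (if r = q then A p q * A q p else 0) else 0))"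
      unfolding sum_distrib_left distrib_left sum.distrib[symmetric]
      by (intro sum.cong refl) (auto simp: algebra_simps)
    also have "\<dots> = s ^ 4 * (T\<^sup>2 + ((\<Sum>p\<in>J. \<Sum>q\<in>J. A p q * A p q) + (\<Sum>p\<in>J. \<Sum>q\<in>J. A p q * A q p)))"
    proof -
      have "(\<Sum>p\<in>J. \<Sum>q\<in>J. \<Sum>r\<in>J. \<Sum>t\<in>J. if t = r then (if q = p then A p p else 0) * A r r else 0)
        = (\<Sum>p\<in>J. \<Sum>q\<in>J. \<Sum>r\<in>J. (if q = p then A p p else 0) * A r r)"
        using J(1) by (intro sum.cong refl) simp
      also have "\<dots> = (\<Sum>p\<in>J. \<Sum>q\<in>J. if q = p then A p p else 0) * (\<Sum>r\<in>J. A r r)"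
        unfolding sum_distrib_right unfolding sum_distrib_left ..
      also have "\<dots> = T\<^sup>2"
        using J(1) by (simp add: T_def power2_eq_square)
      finally have "(\<Sum>p\<in>J. \<Sum>q\<in>J. \<Sum>r\<in>J. \<Sum>t\<in>J. if t = r then (if q = p then A p p else 0) * A r r else 0) = T\<^sup>2" .
      moreover have "(\<Sum>p\<in>J. \<Sum>q\<in>J. \<Sum>r\<in>J. \<Sum>t\<in>J. if t = q then (if r = p then A p q * A p q else 0) else 0)
         = (\<Sum>p\<in>J. \<Sum>q\<in>J. A p q * A p q)"
        using J(1) by (intro sum.cong refl) simp
      moreover have "(\<Sum>p\<in>J. \<Sum>q\<in>J. \<Sum>r\<in>J. \<Sum>t\<in>J. if t = p then (if r = q then A p q * A q p else 0) else 0)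
         = (\<Sum>p\<in>J. \<Sum>q\<in>J. A p q * A q p)"
        using J(1) by (intro sum.cong refl) simp
      ultimately show ?thesis by simp
    qed
    also have "(\<Sum>p\<in>J. \<Sum>q\<in>J. A p q * A p q) + (\<Sum>p\<in>J. \<Sum>q\<in>J. A p q * A q p) = (\<Sum>p\<in>J. \<Sum>q\<in>J. (A p q + A q p)\<^sup>2) / 2"
    proof -
      have "(\<Sum>p\<in>J. \<Sum>q\<in>J. (A p q + A q p)\<^sup>2) = (\<Sum>p\<in>J. \<Sum>q\<in>J. A p q * A p q) + (\<Sum>p\<in>J. \<Sum>q\<in>J. A q p * A q p)
         + 2 * (\<Sum>p\<in>J. \<Sum>q\<in>J. A p q * A q p)"
        unfolding sum_distrib_left sum.distrib[symmetric]
        by (intro sum.cong refl) (simp add: power2_eq_square algebra_simps)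
      also have "(\<Sum>p\<in>J. \<Sum>q\<in>J. A q p * A q p) = (\<Sum>p\<in>J. \<Sum>q\<in>J. A p q * A p q)"
        by (rule sum.swap)
      finally show ?thesis by simp
    qed
    finally show ?thesis .
  qed
  have "expectation (\<lambda>\<omega>. (Q \<omega> - s\<^sup>2)\<^sup>2) = expectation (\<lambda>\<omega>. (Q \<omega>)\<^sup>2 - 2 * s\<^sup>2 * Q \<omega> + s ^ 4)"
    by (intro Bochner_Integration.integral_cong refl) (simp add: power2_eq_square power4_eq_xxxx algebra_simps)
  also have "\<dots> = expectation (\<lambda>\<omega>. (Q \<omega>)\<^sup>2) - 2 * s\<^sup>2 * expectation Q + s ^ 4"
    using iQ iQ2 by (simp add: prob_space)
  finally show ?thesis
    unfolding EQ EQ2 Q_def[symmetric] T_def[symmetric]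
    by (simp add: power2_eq_square power4_eq_xxxx algebra_simps)
qed

subsection \<open>Real sequences and the Schur test\<close>

text \<open>The ratio \<open>i / (i + 1)\<close> is at most 1, so raising it to a power
  \<open>b <= 1\<close> does not make it smaller. Thus \<open>i powr (- b)\<close> drops per step by
  a relative amount of at most \<open>1 / (i + 1)\<close>.\<close>

lemma powr_neg_Suc_lower:
  fixes b :: real
  assumes "0 \<le> b" "b \<le> 1" "i \<ge> 1"
  shows "real i powr (- b) * (1 - 1 / real (Suc i)) \<le> real (Suc i) powr (- b)"
proof -
  have "1 - 1 / real (Suc i) = (real i / real (Suc i)) powr 1"
    using assms by (simp add: field_simps)
  also have "\<dots> \<le> (real i / real (Suc i)) powr b"
    using assms by (intro powr_mono') auto
  also have "\<dots> = real i powr b * real (Suc i) powr (- b)"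
    using assms by (simp add: powr_divide powr_minus_divide)
  finally have "real i powr (- b) * (1 - 1 / real (Suc i)) \<le> real i powr (- b) * (real i powr b * real (Suc i) powr (- b))"
    by (intro mult_left_mono) auto
  also have "\<dots> = real (Suc i) powr (- b)"
    using assms by (simp add: powr_minus)
  finally show ?thesis .
qed

text \<open>Telescoping: \<open>x powr d - (x - 1) powr d\<close> is at least
  \<open>x powr (d - 1) / 2\<close>, because for \<open>d >= 1/2\<close> the power
  \<open>(1 - 1/x) powr d\<close> is at most \<open>sqrt (1 - 1/x)\<close>, hence at most
  \<open>1 - 1 / (2 * x)\<close>.\<close>

lemma sum_powr_le:
  fixes d :: real
  assumes "1 / 2 \<le> d"
  shows "(\<Sum>i=1..n. real i powr (d - 1)) \<le> 2 * real n powr d"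
proof (induction n)
  case (Suc n)
  define x where "x = real (Suc n)"
  have x: "x \<ge> 1" "real n = x - 1" by (auto simp: x_def)
  have "((x - 1) / x) powr d \<le> ((x - 1) / x) powr (1/2)"
    using x assms by (intro powr_mono') auto
  also have "\<dots> = sqrt ((x - 1) / x)" using x by (intro powr_half_sqrt) auto
  also have "\<dots> \<le> 1 - 1 / (2 * x)"
    using x by (intro real_le_lsqrt) (auto simp: field_simps power2_eq_square)
  finally have "x powr d * ((x - 1) / x) powr d \<le> x powr d * (1 - 1 / (2 * x))"
    by (intro mult_left_mono) auto
  moreover have "x powr d * ((x - 1) / x) powr d = (x - 1) powr d"
    using x by (simp add: powr_divide)
  moreover have "x powr d / x = x powr (d - 1)"
    using x by (simp add: powr_diff)
  ultimately have "(x - 1) powr d + x powr (d - 1) / 2 \<le> x powr d"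
    by (simp add: algebra_simps)
  then show ?case
    using Suc by (simp add: x_def)
qed auto

text \<open>Finitely many exceptional indices are absorbed into the constant by adding all their
  ratios \<open>\<bar>f i\<bar> / g i\<close>; this needs \<open>g\<close> to be strictly positive
  there.\<close>

lemma eventually_le_imp_uniform_le:
  fixes f g :: "nat \<Rightarrow> real"
  assumes ev: "eventually (\<lambda>i. f i \<le> C * g i) sequentially" and pos: "\<And>i. i \<ge> m \<Longrightarrow> 0 < g i"
  shows "\<exists>C>0. \<forall>i\<ge>m. f i \<le> C * g i"
proof -
  obtain N where N: "\<And>i. i \<ge> N \<Longrightarrow> f i \<le> C * g i"
    using ev unfolding eventually_sequentially by auto
  define D where "D = 1 + \<bar>C\<bar> + (\<Sum>i\<in>{m..N}. \<bar>f i\<bar> / g i)"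
  have terms: "0 \<le> \<bar>f i\<bar> / g i" if "i \<in> {m..N}" for i
    using pos[of i] that by auto
  have "0 \<le> (\<Sum>i\<in>{m..N}. \<bar>f i\<bar> / g i)" by (intro sum_nonneg terms)
  then have D: "D \<ge> 1" "D \<ge> C" by (auto simp: D_def)
  have "f i \<le> D * g i" if "i \<ge> m" for i
  proof (cases "i \<le> N")
    case True
    then have "\<bar>f i\<bar> / g i \<le> (\<Sum>i\<in>{m..N}. \<bar>f i\<bar> / g i)"
      using that terms by (intro member_le_sum) auto
    then have "\<bar>f i\<bar> / g i \<le> D" unfolding D_def by linarith
    then show ?thesis using pos[OF that] by (simp add: field_simps)
  next
    case False
    then have "f i \<le> C * g i" using N by simp
    also have "\<dots> \<le> D * g i" using D pos[OF that] by (intro mult_right_mono) auto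
    finally show ?thesis .
  qed
  then show ?thesis using D by (intro exI[of _ D]) auto
qed

text \<open>Cauchy-Schwarz after splitting each entry as \<open>sqrt \<bar>X i p\<bar>\<close> times
  its signed square root: one factor is controlled by the column sums and, after exchanging the
  sums, the other by the row sums.\<close>

lemma schur_test:
  fixes X :: "'i \<Rightarrow> 'p \<Rightarrow> real"
  assumes row: "\<And>i. i \<in> I \<Longrightarrow> (\<Sum>p\<in>P. \<bar>X i p\<bar>) \<le> K" and col: "\<And>p. p \<in> P \<Longrightarrow> (\<Sum>i\<in>I. \<bar>X i p\<bar>) \<le> K"
    and K: "K \<ge> 0"
  shows "(\<Sum>p\<in>P. (\<Sum>i\<in>I. X i p * f i)\<^sup>2) \<le> K\<^sup>2 * (\<Sum>i\<in>I. (f i)\<^sup>2)"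
proof -
  have "(\<Sum>i\<in>I. X i p * f i)\<^sup>2 \<le> K * (\<Sum>i\<in>I. \<bar>X i p\<bar> * (f i)\<^sup>2)" if "p \<in> P" for p
  proof -
    have "(\<Sum>i\<in>I. X i p * f i)\<^sup>2 = (\<Sum>i\<in>I. sqrt \<bar>X i p\<bar> * (sgn (X i p) * sqrt \<bar>X i p\<bar> * f i))\<^sup>2"
    proof -
      have "X i p * f i = sqrt \<bar>X i p\<bar> * (sgn (X i p) * sqrt \<bar>X i p\<bar> * f i)" for i
      proof -
        have "sgn (X i p) * (sqrt \<bar>X i p\<bar> * sqrt \<bar>X i p\<bar>) = X i p"
          by (simp add: sgn_mult_abs)
        then have "X i p * f i = sgn (X i p) * (sqrt \<bar>X i p\<bar> * sqrt \<bar>X i p\<bar>) * f i" by (simp only:)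
        then show ?thesis by (simp only: mult_ac)
      qed
      then show ?thesis by (simp only:)
    qed
    also have "\<dots> \<le> (\<Sum>i\<in>I. (sqrt \<bar>X i p\<bar>)\<^sup>2) * (\<Sum>i\<in>I. (sgn (X i p) * sqrt \<bar>X i p\<bar> * f i)\<^sup>2)"
      by (rule Cauchy_Schwarz_ineq_sum)
    also have "\<dots> = (\<Sum>i\<in>I. \<bar>X i p\<bar>) * (\<Sum>i\<in>I. \<bar>X i p\<bar> * (f i)\<^sup>2)"
      by (intro arg_cong2[of _ _ _ _ "(*)"] sum.cong refl) (auto simp: power_mult_distrib sgn_if)
    also have "\<dots> \<le> K * (\<Sum>i\<in>I. \<bar>X i p\<bar> * (f i)\<^sup>2)"
      using col[OF that] by (intro mult_right_mono sum_nonneg) auto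
    finally show ?thesis .
  qed
  then have "(\<Sum>p\<in>P. (\<Sum>i\<in>I. X i p * f i)\<^sup>2) \<le> (\<Sum>p\<in>P. K * (\<Sum>i\<in>I. \<bar>X i p\<bar> * (f i)\<^sup>2))"
    by (rule sum_mono)
  also have "\<dots> = K * (\<Sum>i\<in>I. (\<Sum>p\<in>P. \<bar>X i p\<bar>) * (f i)\<^sup>2)"
    unfolding sum_distrib_left[symmetric] sum_distrib_right by (subst sum.swap) simp
  also have "\<dots> \<le> K * (\<Sum>i\<in>I. K * (f i)\<^sup>2)"
    using row K by (intro mult_left_mono sum_mono mult_right_mono) auto
  finally show ?thesis by (simp add: sum_distrib_left power2_eq_square mult_ac)
qed

text \<open>The Schur test applied twice, once for each of the two factors \<open>X\<close> around
  \<open>W\<close>; each application costs \<open>K\<^sup>2\<close>.\<close>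

lemma schur_test_congruence:
  fixes X :: "'i \<Rightarrow> 'p \<Rightarrow> real"
  assumes row: "\<And>i. i \<in> I \<Longrightarrow> (\<Sum>p\<in>P. \<bar>X i p\<bar>) \<le> K" and col: "\<And>p. p \<in> P \<Longrightarrow> (\<Sum>i\<in>I. \<bar>X i p\<bar>) \<le> K"
    and K: "K \<ge> 0"
  shows "(\<Sum>p\<in>P. \<Sum>q\<in>P. (\<Sum>i\<in>I. \<Sum>k\<in>I. W i k * X i p * X k q)\<^sup>2) \<le> K ^ 4 * (\<Sum>i\<in>I. \<Sum>k\<in>I. (W i k)\<^sup>2)"
proof -
  have "(\<Sum>p\<in>P. \<Sum>q\<in>P. (\<Sum>i\<in>I. \<Sum>k\<in>I. W i k * X i p * X k q)\<^sup>2)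
      = (\<Sum>q\<in>P. \<Sum>p\<in>P. (\<Sum>i\<in>I. X i p * (\<Sum>k\<in>I. X k q * W i k))\<^sup>2)"
    by (subst sum.swap) (simp add: sum_distrib_left mult_ac)
  also have "\<dots> \<le> (\<Sum>q\<in>P. K\<^sup>2 * (\<Sum>i\<in>I. (\<Sum>k\<in>I. X k q * W i k)\<^sup>2))"
    by (intro sum_mono schur_test assms)
  also have "\<dots> = K\<^sup>2 * (\<Sum>i\<in>I. \<Sum>q\<in>P. (\<Sum>k\<in>I. X k q * W i k)\<^sup>2)"
    unfolding sum_distrib_left[symmetric] by (subst sum.swap) simp
  also have "\<dots> \<le> K\<^sup>2 * (\<Sum>i\<in>I. K\<^sup>2 * (\<Sum>k\<in>I. (W i k)\<^sup>2))"
    by (intro mult_left_mono sum_mono schur_test assms) auto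
  finally show ?thesis
    by (simp add: sum_distrib_left[symmetric] power2_eq_square power4_eq_xxxx mult_ac)
qed

subsection \<open>Response of the iterates to the noise\<close>

locale sgd_steps =
  fixes eta alpha :: real
  assumes eta_pos: "0 < eta" and alpha_gt: "1 / 2 < alpha" and alpha_lt: "alpha < 1"
begin

definition step :: "nat \<Rightarrow> real" where
  "step k = eta * real k powr (- alpha)"

text \<open>The factor by which the state at time \<open>j\<close> survives until time
  \<open>i\<close>. Since \<open>eta\<close> is arbitrary, early factors may be negative.\<close>

definition decay :: "nat \<Rightarrow> nat \<Rightarrow> real" where
  "decay j i = (\<Prod>k\<in>{j<..i}. 1 - step k)"

text \<open>Weight of the noise with index \<open>p\<close> in the iterate with index
  \<open>i\<close>. The guard \<open>p \<le> i\<close> matters: for \<open>i < p\<close> the empty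
  product makes \<open>decay p i\<close> equal to 1.\<close>

definition kern :: "nat \<Rightarrow> nat \<Rightarrow> real" where
  "kern i p = (if 1 \<le> p \<and> p \<le> i then step p * decay p i else 0)"

text \<open>Variance of the iterate, divided by the noise variance.\<close>

definition nvar :: "nat \<Rightarrow> real" where
  "nvar k = (\<Sum>p=1..k. (kern k p)\<^sup>2)"

text \<open>Sum over \<open>k \<le> i\<close> of the covariances of the iterates \<open>i\<close>
  and \<open>k\<close>, divided by the noise variance; see \<open>kern_cov\<close>.\<close>

definition cumcov :: "nat \<Rightarrow> real" where
  "cumcov i = (\<Sum>k=1..i. decay k i * nvar k)"

section \<open>Size and variation of the step sizes\<close>

lemma step_pos: "k \<ge> 1 \<Longrightarrow> 0 < step k"
  using eta_pos by (simp add: step_def)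

lemma step_nonneg: "0 \<le> step k"
  using eta_pos by (simp add: step_def)

lemma step_antimono: "1 \<le> j \<Longrightarrow> j \<le> k \<Longrightarrow> step k \<le> step j"
  using eta_pos alpha_gt by (auto simp: step_def intro!: powr_mono2')

lemma step_tendsto: "step \<longlonglongrightarrow> 0"
proof -
  have "(\<lambda>k. eta * real k powr (- alpha)) \<longlonglongrightarrow> eta * 0"
    using alpha_gt by (intro tendsto_intros tendsto_neg_powr filterlim_real_sequentially) auto
  then show ?thesis by (simp add: step_def[abs_def])
qed

lemma eventually_step_le: "0 < c \<Longrightarrow> eventually (\<lambda>k. step k \<le> c) sequentially"
  using order_tendstoD(2)[OF step_tendsto, of c] by (auto elim: eventually_mono)

text \<open>As \<open>alpha < 1\<close>, the product \<open>k * step k\<close> is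
  \<open>eta * k powr (1 - alpha)\<close> and diverges, so contraction eventually beats any
  polynomial drift.\<close>

lemma eventually_step_ge: "eventually (\<lambda>k. c / real k \<le> step k) sequentially"
proof -
  have "filterlim (\<lambda>k. real k powr (1 - alpha)) at_top sequentially"
    using alpha_lt by (intro filterlim_compose[OF real_powr_at_top filterlim_real_sequentially]) auto
  then have "eventually (\<lambda>k. c / eta \<le> real k powr (1 - alpha)) sequentially"
    by (simp add: filterlim_at_top)
  then show ?thesis
    using eventually_gt_at_top[of 0]
  proof eventually_elim
    case (elim k)
    then have "c \<le> eta * real k powr (1 - alpha)"
      using eta_pos by (simp add: field_simps)
    also have "real k powr (1 - alpha) = real k * real k powr (- alpha)"
      using elim by (simp add: powr_diff powr_minus divide_inverse)
    finally show ?case using elim by (simp add: step_def field_simps)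
  qed
qed

lemma step_diff_le: "i \<ge> 1 \<Longrightarrow> step i - step (Suc i) \<le> 2 * step (Suc i) / real (Suc i)"
  and step_le_double: "i \<ge> 1 \<Longrightarrow> step i \<le> 2 * step (Suc i)"
proof -
  assume i: "i \<ge> 1"
  have "eta * (real i powr (- alpha) * (1 - 1 / real (Suc i))) \<le> eta * (real (Suc i) powr (- alpha))"
    using eta_pos alpha_gt alpha_lt i by (intro mult_left_mono powr_neg_Suc_lower) auto
  then have 1: "step i * (1 - 1 / real (Suc i)) \<le> step (Suc i)"
    by (simp add: step_def mult_ac)
  have "step i * (1 / 2) \<le> step i * (1 - 1 / real (Suc i))"
    using i step_nonneg by (intro mult_left_mono) (auto simp: field_simps)
  with 1 show 2: "step i \<le> 2 * step (Suc i)" by linarith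
  have "step i - step (Suc i) \<le> step i / real (Suc i)"
    using 1 by (simp add: algebra_simps)
  also have "\<dots> \<le> 2 * step (Suc i) / real (Suc i)"
    using 2 by (intro divide_right_mono) auto
  finally show "step i - step (Suc i) \<le> 2 * step (Suc i) / real (Suc i)" .
qed

text \<open>A sequence contracted by \<open>1 - step\<close> and forced at \<open>step\<close> times
  a power follows that power: the power itself decreases by a relative amount of at most
  \<open>1 / (i + 1)\<close>, at most half of the step once the step is at least
  \<open>2 / (i + 1)\<close>. The remaining half of the contraction absorbs the forcing.\<close>

lemma relaxation_bound:
  fixes y :: "nat \<Rightarrow> real"
  assumes b: "0 \<le> b" "b \<le> 1"
    and rec: "eventually (\<lambda>i. y (Suc i) \<le> (1 - step (Suc i)) * y i + step (Suc i) * (K * real (Suc i) powr (- b))) sequentially"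
  shows "\<exists>C>0. \<forall>i\<ge>1. y i \<le> C * real i powr (- b)"
proof -
  have "eventually (\<lambda>i. step i \<le> 1) sequentially"
    by (rule eventually_step_le) auto
  then have ev1: "eventually (\<lambda>i. step (Suc i) \<le> 1) sequentially"
    by (rule eventually_sequentially_Suc[of "\<lambda>i. step i \<le> 1", THEN iffD2])
  have "eventually (\<lambda>i. 2 / real i \<le> step i) sequentially"
    by (rule eventually_step_ge)
  then have ev2: "eventually (\<lambda>i. 2 / real (Suc i) \<le> step (Suc i)) sequentially"
    by (rule eventually_sequentially_Suc[of "\<lambda>i. 2 / real i \<le> step i", THEN iffD2])
  from eventually_conj[OF rec eventually_conj[OF ev1 ev2]]
  obtain N0 where N0: "\<And>i. i \<ge> N0 \<Longrightarrow> y (Suc i) \<le> (1 - step (Suc i)) * y i + step (Suc i) * (K * real (Suc i) powr (- b))"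
     "\<And>i. i \<ge> N0 \<Longrightarrow> step (Suc i) \<le> 1" "\<And>i. i \<ge> N0 \<Longrightarrow> 2 / real (Suc i) \<le> step (Suc i)"
    unfolding eventually_sequentially by auto
  define N where "N = Suc N0"
  \<comment> \<open>The term \<open>2 * \<bar>K\<bar>\<close> lets \<open>C / 2\<close> dominate the
    forcing constant; the sum covers the indices up to \<open>N\<close>, before the induction
    starts.\<close>
  define C where "C = 1 + 2 * \<bar>K\<bar> + (\<Sum>i=1..N. \<bar>y i\<bar> * real i powr b)"
  have "0 \<le> (\<Sum>i=1..N. \<bar>y i\<bar> * real i powr b)" by (intro sum_nonneg) auto
  then have C: "C \<ge> 1" "2 * K \<le> C" by (auto simp: C_def)
  have small: "y i \<le> C * real i powr (- b)" if "1 \<le> i" "i \<le> N" for i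
  proof -
    have "\<bar>y i\<bar> * real i powr b \<le> (\<Sum>i=1..N. \<bar>y i\<bar> * real i powr b)"
      using that by (intro member_le_sum) auto
    then have "\<bar>y i\<bar> * real i powr b \<le> C" unfolding C_def by linarith
    then have "\<bar>y i\<bar> * real i powr b * real i powr (- b) \<le> C * real i powr (- b)"
      by (intro mult_right_mono) auto
    then show ?thesis using that by (simp add: mult.assoc flip: powr_add)
  qed
  have large: "y i \<le> C * real i powr (- b)" if "i \<ge> N" for i
    using that
  proof (induction i rule: dec_induct)
    case base
    show ?case using small[of N] by (simp add: N_def)
  next
    case (step i)
    have i: "i \<ge> 1" "i \<ge> N0" using step by (auto simp: N_def)
    define s where "s = step (Suc i)"
    have s: "s \<le> 1" "2 / real (Suc i) \<le> s" "s \<ge> 0"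
      using N0[OF i(2)] step_nonneg by (auto simp: s_def)
    define u where "u = real i powr (- b)"
    define u' where "u' = real (Suc i) powr (- b)"
    have u': "u * (1 - 1 / real (Suc i)) \<le> u'" "u \<ge> 0" "u' \<ge> 0"
      using powr_neg_Suc_lower[OF b i(1)] by (auto simp: u_def u'_def)
    \<comment> \<open>Bounding \<open>1 - s\<close> by the square of \<open>1 - s / 2\<close> yields
      two factors: one pays for passing from \<open>u\<close> to \<open>u'\<close>, the other stays
      as contraction.\<close>
    have "(1 - s) * u \<le> (1 - s / 2) * (1 - s / 2) * u"
      using u' by (intro mult_right_mono) (auto simp: algebra_simps)
    also have "\<dots> \<le> (1 - s / 2) * ((1 - 1 / real (Suc i)) * u)"
      unfolding mult.assoc using s u' by (intro mult_left_mono mult_right_mono) auto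
    also have "\<dots> \<le> (1 - s / 2) * u'"
      using s u' by (intro mult_left_mono) (auto simp: mult.commute)
    finally have key: "(1 - s) * u \<le> (1 - s / 2) * u'" .
    have "y (Suc i) \<le> (1 - s) * y i + s * (K * u')"
      using N0(1)[OF i(2)] by (simp add: s_def u'_def)
    also have "\<dots> \<le> (1 - s) * (C * u) + s * (C / 2 * u')"
      using step.IH s C u' by (intro add_mono mult_left_mono mult_right_mono) (auto simp: u_def)
    also have "\<dots> = C * ((1 - s) * u) + s * (C / 2 * u')" by simp
    also have "\<dots> \<le> C * ((1 - s / 2) * u') + s * (C / 2 * u')"
      using key C s by (intro add_mono mult_left_mono) auto
    also have "\<dots> = C * u'" by (simp add: algebra_simps)
    finally show ?case by (simp add: u'_def)
  qed
  have "y i \<le> C * real i powr (- b)" if "1 \<le> i" for i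
    using small[OF that] large[of i] by (cases "i \<le> N") auto
  then show ?thesis using C by (intro exI[of _ C]) auto
qed

section \<open>Unrolling the recursion into a linear response to the noise\<close>

lemma decay_self [simp]: "decay j j = 1"
  by (simp add: decay_def)

lemma decay_Suc: "j \<le> i \<Longrightarrow> decay j (Suc i) = (1 - step (Suc i)) * decay j i"
proof -
  assume "j \<le> i"
  then have "{j<..Suc i} = insert (Suc i) {j<..i}" by auto
  then show ?thesis by (simp add: decay_def)
qed

lemma decay_mult: "j \<le> k \<Longrightarrow> k \<le> i \<Longrightarrow> decay j i = decay j k * decay k i"
  by (induction i rule: nat_induct)
     (auto simp: le_Suc_eq decay_Suc)

lemma kern_Suc: "p \<le> i \<Longrightarrow> kern (Suc i) p = (1 - step (Suc i)) * kern i p"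
  by (auto simp: kern_def decay_Suc)

lemma kern_self: "1 \<le> p \<Longrightarrow> kern p p = step p"
  by (simp add: kern_def)

lemma kern_eq_0: "i < p \<Longrightarrow> kern i p = 0"
  by (simp add: kern_def)

lemma sgd_iter_eq: "sgd_iter eta alpha xi i = (\<Sum>p=1..i. kern i p * xi p)"
proof (induction i)
  case (Suc i)
  have "(\<Sum>p=1..Suc i. kern (Suc i) p * xi p) = (\<Sum>p=1..i. kern (Suc i) p * xi p) + step (Suc i) * xi (Suc i)"
    by (simp add: kern_self)
  also have "(\<Sum>p=1..i. kern (Suc i) p * xi p) = (1 - step (Suc i)) * (\<Sum>p=1..i. kern i p * xi p)"
    unfolding sum_distrib_left by (intro sum.cong) (auto simp: kern_Suc)
  finally show ?case
    using Suc by (simp add: step_def algebra_simps)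
qed auto

text \<open>Noise after time \<open>k\<close> does not enter iterate \<open>k\<close>, and all
  earlier noise is damped by the same extra factor \<open>decay k i\<close> between times
  \<open>k\<close> and \<open>i\<close>.\<close>

lemma kern_cov:
  assumes "k \<le> i" "i \<le> n"
  shows "(\<Sum>p=1..n. kern i p * kern k p) = decay k i * nvar k"
proof -
  have "(\<Sum>p=1..n. kern i p * kern k p) = (\<Sum>p=1..k. kern i p * kern k p)"
    using assms by (intro sum.mono_neutral_right) (auto simp: kern_eq_0)
  also have "\<dots> = (\<Sum>p=1..k. decay k i * (kern k p)\<^sup>2)"
  proof (intro sum.cong refl)
    fix p assume p: "p \<in> {1..k}"
    then have "decay p i = decay p k * decay k i" using assms by (intro decay_mult) auto
    then show "kern i p * kern k p = decay k i * (kern k p)\<^sup>2"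
      using p assms by (simp add: kern_def power2_eq_square)
  qed
  finally show ?thesis by (simp add: nvar_def sum_distrib_left)
qed

lemma nvar_Suc: "nvar (Suc i) = (1 - step (Suc i))\<^sup>2 * nvar i + (step (Suc i))\<^sup>2"
proof -
  have "(\<Sum>p=1..i. (kern (Suc i) p)\<^sup>2) = (1 - step (Suc i))\<^sup>2 * (\<Sum>p=1..i. (kern i p)\<^sup>2)"
    unfolding sum_distrib_left by (intro sum.cong) (auto simp: kern_Suc power_mult_distrib)
  then show ?thesis by (simp add: nvar_def kern_self)
qed

lemma cumcov_Suc: "cumcov (Suc i) = nvar (Suc i) + (1 - step (Suc i)) * cumcov i"
proof -
  have "(\<Sum>k=1..i. decay k (Suc i) * nvar k) = (1 - step (Suc i)) * cumcov i"
    unfolding cumcov_def sum_distrib_left by (intro sum.cong) (auto simp: decay_Suc)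
  then show ?thesis by (simp add: cumcov_def)
qed

section \<open>Consequences of the relaxation bound: variance, cumulative covariance, row
  sums\<close>

lemma eventually_Suc_steps:
  "eventually (\<lambda>i. i \<ge> 1 \<and> step (Suc i) \<le> 1) sequentially"
proof -
  have "eventually (\<lambda>i. step i \<le> 1) sequentially"
    by (rule eventually_step_le) auto
  then have "eventually (\<lambda>i. step (Suc i) \<le> 1) sequentially"
    by (rule eventually_sequentially_Suc[of "\<lambda>i. step i \<le> 1", THEN iffD2])
  then show ?thesis by (intro eventually_conj eventually_ge_at_top)
qed

text \<open>For a frozen step \<open>t\<close> the variance recursion balances at about
  \<open>t / 2\<close>. The exponent lies midway between \<open>alpha\<close> and 1; its excess over
  \<open>alpha\<close> is \<open>(1 - alpha) / 2\<close>, which after squaring matches the rate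
  \<open>n powr (alpha - 1)\<close>.\<close>

lemma nvar_asymp: "\<exists>C>0. \<forall>i\<ge>1. \<bar>nvar i - step i / 2\<bar> \<le> C * real i powr (- ((1 + alpha) / 2))"
proof (rule relaxation_bound)
  show "eventually (\<lambda>i. \<bar>nvar (Suc i) - step (Suc i) / 2\<bar> \<le> (1 - step (Suc i)) * \<bar>nvar i - step i / 2\<bar>
      + step (Suc i) * ((4 + eta\<^sup>2) * real (Suc i) powr (- ((1 + alpha) / 2)))) sequentially"
    using eventually_Suc_steps
  proof eventually_elim
    case (elim i)
    define s where "s = step i"
    define t where "t = step (Suc i)"
    define x where "x = real (Suc i)"
    have t: "0 < t" "t \<le> 1" "t \<le> s" "s \<le> 2 * t" "s - t \<le> 2 * t / x"
      using elim step_pos[of "Suc i"] step_antimono[of i "Suc i"] step_le_double[of i] step_diff_le[of i]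
      by (auto simp: s_def t_def x_def)
    define d where "d = x powr (- ((1 + alpha) / 2))"
    have "x powr (-1) \<le> d"
      unfolding d_def using alpha_lt by (intro powr_mono) (auto simp: x_def)
    then have xd: "1 / x \<le> d" by (simp add: x_def powr_minus_divide)
    have "t\<^sup>2 = eta\<^sup>2 * x powr (- alpha + - alpha)"
      unfolding powr_add by (simp add: t_def step_def power2_eq_square x_def)
    also have "x powr (- alpha + - alpha) \<le> d"
      unfolding d_def using alpha_gt by (intro powr_mono) (auto simp: x_def)
    finally have td: "t\<^sup>2 \<le> eta\<^sup>2 * d" by (simp add: mult_left_mono)
    \<comment> \<open>Exact identity: the fresh noise \<open>t\<^sup>2\<close> cancels the leading
      part of \<open>t * s\<close>, so what remains is the drift \<open>s - t\<close> of the step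
      and a cubic term.\<close>
    have "nvar (Suc i) - t / 2 = (1 - t)\<^sup>2 * (nvar i - s / 2) + ((s - t) / 2 - t * (s - t) + t\<^sup>2 * s / 2)"
      unfolding nvar_Suc t_def[symmetric] by (simp add: power2_eq_square field_simps)
    also have "\<bar>\<dots>\<bar> \<le> (1 - t)\<^sup>2 * \<bar>nvar i - s / 2\<bar> + ((s - t) / 2 + t * (s - t) + t\<^sup>2 * s / 2)"
    proof -
      have "0 \<le> (s - t) / 2" "0 \<le> t * (s - t)" "0 \<le> t\<^sup>2 * s / 2" using t by auto
      moreover have "\<bar>(1 - t)\<^sup>2 * (nvar i - s / 2)\<bar> = (1 - t)\<^sup>2 * \<bar>nvar i - s / 2\<bar>"
        by (simp add: abs_mult)
      moreover have "\<bar>u + (a - b + c)\<bar> \<le> v + (a + b + c)" if "0 \<le> a" "0 \<le> b" "0 \<le> c" "\<bar>u\<bar> = v" for a b c u v :: real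
        using that by linarith
      ultimately show ?thesis by metis
    qed
    also have "(1 - t)\<^sup>2 * \<bar>nvar i - s / 2\<bar> \<le> (1 - t) * \<bar>nvar i - s / 2\<bar>"
      using t by (intro mult_right_mono) (auto simp: power2_eq_square mult_left_le)
    also have "(s - t) / 2 + t * (s - t) + t\<^sup>2 * s / 2 \<le> t * ((4 + eta\<^sup>2) * d)"
    proof -
      have "t * (s - t) \<le> 1 * (s - t)" using t by (intro mult_right_mono) auto
      moreover have "s - t \<le> 2 * (t * d)" using xd t mult_left_mono[of "1/x" d "2*t"] by simp
      moreover have "t\<^sup>2 * s / 2 \<le> t * (eta\<^sup>2 * d)"
      proof -
        have "t\<^sup>2 * s / 2 \<le> t\<^sup>2 * t" using t by (simp add: mult_left_mono)
        also have "\<dots> \<le> eta\<^sup>2 * d * t" using td t by (intro mult_right_mono) auto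
        finally show ?thesis by (simp add: mult_ac)
      qed
      moreover have "0 \<le> t * d" using t by (simp add: d_def)
      moreover have "t * ((4 + eta\<^sup>2) * d) = 4 * (t * d) + t * (eta\<^sup>2 * d)" by (simp add: algebra_simps)
      moreover have "a / 2 + b + c \<le> 4 * w + e" if "b \<le> 1 * a" "a \<le> 2 * w" "c \<le> e" "0 \<le> w" for a b c w e :: real
        using that by linarith
      ultimately show ?thesis by metis
    qed
    finally show ?case by (simp add: s_def t_def d_def x_def)
  qed
qed (use alpha_gt alpha_lt in auto)

text \<open>The recursion adds \<open>nvar\<close>, about \<open>step / 2\<close>, and contracts by
  \<open>1 - step\<close>, so it balances at \<open>1/2\<close>. Dividing the error of
  \<open>nvar\<close> by the step leaves the exponent \<open>(1 - alpha) / 2\<close>.\<close>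

lemma cumcov_asymp: "\<exists>C>0. \<forall>i\<ge>1. \<bar>cumcov i - 1 / 2\<bar> \<le> C * real i powr (- ((1 - alpha) / 2))"
proof -
  obtain C where C: "C > 0" "\<And>i. i \<ge> 1 \<Longrightarrow> \<bar>nvar i - step i / 2\<bar> \<le> C * real i powr (- ((1 + alpha) / 2))"
    using nvar_asymp by auto
  show ?thesis
  proof (rule relaxation_bound)
    show "eventually (\<lambda>i. \<bar>cumcov (Suc i) - 1 / 2\<bar> \<le> (1 - step (Suc i)) * \<bar>cumcov i - 1 / 2\<bar>
        + step (Suc i) * (C / eta * real (Suc i) powr (- ((1 - alpha) / 2)))) sequentially"
      using eventually_Suc_steps
    proof eventually_elim
      case (elim i)
      define t where "t = step (Suc i)"
      have t: "0 < t" "t \<le> 1" using elim step_pos[of "Suc i"] by (auto simp: t_def)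
      have "cumcov (Suc i) - 1 / 2 = (1 - t) * (cumcov i - 1 / 2) + (nvar (Suc i) - t / 2)"
        unfolding cumcov_Suc t_def[symmetric] by (simp add: field_simps)
      also have "\<bar>\<dots>\<bar> \<le> (1 - t) * \<bar>cumcov i - 1 / 2\<bar> + \<bar>nvar (Suc i) - t / 2\<bar>"
        using t by (intro order_trans[OF abs_triangle_ineq]) (auto simp: abs_mult)
      also have "\<bar>nvar (Suc i) - t / 2\<bar> \<le> C * real (Suc i) powr (- ((1 + alpha) / 2))"
        unfolding t_def using C(2)[of "Suc i"] by simp
      also have "- ((1 + alpha) / 2) = - alpha + - ((1 - alpha) / 2)" by (simp add: field_simps)
      also have "C * real (Suc i) powr (- alpha + - ((1 - alpha) / 2)) = t * (C / eta * real (Suc i) powr (- ((1 - alpha) / 2)))"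
        unfolding powr_add t_def step_def using eta_pos by simp
      finally show ?case by (simp add: t_def)
    qed
  qed (use alpha_gt alpha_lt in auto)
qed

text \<open>Once the steps are at most 1, the absolute row sum obeys the relaxation recursion with
  constant forcing 1, so the relaxation bound applies with exponent 0.\<close>

lemma kern_row_sum_bounded: "\<exists>K>0. \<forall>i. (\<Sum>p=1..i. \<bar>kern i p\<bar>) \<le> K"
proof -
  have "\<exists>C>0. \<forall>i\<ge>1. (\<Sum>p=1..i. \<bar>kern i p\<bar>) \<le> C * real i powr (- 0)"
  proof (rule relaxation_bound)
    show "eventually (\<lambda>i. (\<Sum>p=1..Suc i. \<bar>kern (Suc i) p\<bar>) \<le> (1 - step (Suc i)) * (\<Sum>p=1..i. \<bar>kern i p\<bar>)
        + step (Suc i) * (1 * real (Suc i) powr (- 0))) sequentially"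
      using eventually_Suc_steps
    proof eventually_elim
      case (elim i)
      have "(\<Sum>p=1..i. \<bar>kern (Suc i) p\<bar>) = (1 - step (Suc i)) * (\<Sum>p=1..i. \<bar>kern i p\<bar>)"
        unfolding sum_distrib_left using elim by (intro sum.cong) (auto simp: kern_Suc abs_mult)
      then show ?case using step_nonneg[of "Suc i"] by (simp add: kern_self)
    qed
  qed auto
  then obtain C where C: "C > 0" "\<And>i. i \<ge> 1 \<Longrightarrow> (\<Sum>p=1..i. \<bar>kern i p\<bar>) \<le> C * real i powr (- 0)" by auto
  have "(\<Sum>p=1..i. \<bar>kern i p\<bar>) \<le> C" for i
    using C(1) C(2)[of i] by (cases "i \<ge> 1") auto
  then show ?thesis using C(1) by auto
qed

section \<open>Column sums of the noise kernel\<close>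

lemma decay_nonneg:
  assumes "\<And>k. k > j \<Longrightarrow> step k \<le> 1"
  shows "0 \<le> decay j i"
  unfolding decay_def using assms by (intro prod_nonneg) auto

text \<open>A perturbation at time \<open>j\<close> persists for about \<open>1 / step j\<close>
  iterations; multiplying by the noise weight \<open>step j\<close> then gives a uniform column
  bound.\<close>

lemma decay_sum_bounded: "\<exists>N\<ge>1. (\<forall>k\<ge>N. step k \<le> 1) \<and> (\<forall>j\<ge>N. \<forall>n. (\<Sum>i=j..n. decay j i) \<le> 4 / step j)"
proof -
  have "eventually (\<lambda>k. step k \<le> 1) sequentially" "eventually (\<lambda>k. 4 / real k \<le> step k) sequentially"
    by (auto intro: eventually_step_le eventually_step_ge)
  from eventually_conj[OF this] obtain N0 where
    N0: "\<And>k. k \<ge> N0 \<Longrightarrow> step k \<le> 1" "\<And>k. k \<ge> N0 \<Longrightarrow> 4 / real k \<le> step k"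
    unfolding eventually_sequentially by auto
  define N where "N = Suc N0"
  text \<open>The potential \<open>2 * decay j n / step (n + 1)\<close> drops by at least \<open>decay j n\<close> per step.\<close>
  have main: "(\<Sum>i\<in>{j..<n}. decay j i) + 2 * decay j n / step (Suc n) \<le> 2 / step (Suc j)"
    if "N \<le> j" "j \<le> n" for j n
    using that(2)
  proof (induction n rule: dec_induct)
    case (step n)
    define s where "s = step (Suc n)"
    define r where "r = step (Suc (Suc n))"
    define x where "x = real (Suc (Suc n))"
    have s: "s \<le> 1" "4 / real (Suc n) \<le> s" "0 < s" "0 < r" "s - r \<le> 2 * r / x"
      using N0[of "Suc n"] step that step_pos[of "Suc n"] step_pos[of "Suc (Suc n)"] step_diff_le[of "Suc n"]
      by (auto simp: s_def r_def x_def N_def)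
    have "4 / x \<le> 4 / real (Suc n)" by (intro divide_left_mono) (auto simp: x_def)
    with s have x: "4 / x \<le> s" "x > 0" by (auto simp: x_def)
    \<comment> \<open>\<open>y\<close> bounds the relative loss when the step goes from
      \<open>s\<close> to \<open>r\<close>. The threshold \<open>4 / k\<close> makes it at most
      \<open>s / 2\<close>, so half of the contraction survives.\<close>
    define y where "y = 2 / x"
    have y: "0 \<le> s * y" "y \<le> s / 2" using s x by (auto simp: y_def)
    have "s \<le> r * (1 + y)" using s by (simp add: algebra_simps y_def)
    then have "(1 - s) * s \<le> (1 - s) * (r * (1 + y))" using s by (intro mult_left_mono) auto
    also have "\<dots> = r * (1 - s + y - s * y)" by (simp add: algebra_simps)
    also have "\<dots> \<le> r * (1 - s / 2)"
      using s y by (intro mult_left_mono) auto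
    finally have "1 + 2 * (1 - s) / r \<le> 2 / s" using s by (simp add: field_simps)
    moreover have "0 \<le> decay j n"
      using N0 that by (intro decay_nonneg) (auto simp: N_def)
    ultimately have "decay j n * (1 + 2 * (1 - s) / r) \<le> decay j n * (2 / s)" by (intro mult_left_mono) auto
    then have "decay j n + 2 * decay j (Suc n) / r \<le> 2 * decay j n / s"
      using step by (simp add: decay_Suc s_def[symmetric] algebra_simps)
    then show ?case using step by (simp add: s_def r_def)
  qed auto
  have "(\<Sum>i=j..n. decay j i) \<le> 4 / step j" if "j \<ge> N" for j n
  proof (cases "j \<le> Suc n")
    case True
    have "0 \<le> decay j (Suc n)"
      using N0 that by (intro decay_nonneg) (auto simp: N_def)
    then have "0 \<le> 2 * decay j (Suc n) / step (Suc (Suc n))"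
      using step_nonneg by simp
    then have "(\<Sum>i=j..n. decay j i) \<le> 2 / step (Suc j)"
      using main[OF that True] by (simp add: atLeastLessThanSuc_atLeastAtMost)
    also have "\<dots> \<le> 4 / step j"
      using step_le_double[of j] step_pos[of j] step_pos[of "Suc j"] that by (simp add: N_def field_simps)
    finally show ?thesis .
  next
    case False
    then show ?thesis using step_nonneg[of j] by simp
  qed
  then show ?thesis using N0 by (intro exI[of _ N]) (auto simp: N_def)
qed

text \<open>For \<open>p \<ge> N\<close> the entries are nonnegative and
  \<open>decay_sum_bounded\<close> applies directly. The finitely many earlier columns are
  propagated through time \<open>N\<close>, each with its own constant \<open>B p\<close>, and these
  are summed.\<close>

lemma kern_column_sum_bounded: "\<exists>K>0. \<forall>p n. (\<Sum>i=1..n. \<bar>kern i p\<bar>) \<le> K"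
proof -
  obtain N where N: "N \<ge> 1" "\<And>k. k \<ge> N \<Longrightarrow> step k \<le> 1"
     "\<And>j n. j \<ge> N \<Longrightarrow> (\<Sum>i=j..n. decay j i) \<le> 4 / step j"
    using decay_sum_bounded by auto
  define B where "B p = (\<Sum>i=1..N. \<bar>kern i p\<bar>) + \<bar>step p * decay p N\<bar> * (4 / step N)" for p
  have B: "0 \<le> B p" for p
    unfolding B_def using step_nonneg by (intro add_nonneg_nonneg sum_nonneg mult_nonneg_nonneg) auto
  have decay_N: "0 \<le> decay j i" if "j \<ge> N" for i j
    using that N by (intro decay_nonneg) auto
  have big: "(\<Sum>i=1..n. \<bar>kern i p\<bar>) \<le> 4" if "p \<ge> N" for p n
  proof -
    have "(\<Sum>i=1..n. \<bar>kern i p\<bar>) = (\<Sum>i=p..n. \<bar>kern i p\<bar>)"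
      using that N by (intro sum.mono_neutral_right) (auto simp: kern_def)
    also have "\<dots> = step p * (\<Sum>i=p..n. decay p i)"
      unfolding sum_distrib_left using that N decay_N step_nonneg
      by (intro sum.cong) (auto simp: kern_def abs_mult)
    also have "\<dots> \<le> step p * (4 / step p)"
      using N that step_nonneg by (intro mult_left_mono) auto
    also have "\<dots> = 4" using step_pos[of p] that N by simp
    finally show ?thesis .
  qed
  have little: "(\<Sum>i=1..n. \<bar>kern i p\<bar>) \<le> B p" if "p < N" for p n
  proof -
    have "(\<Sum>i=1..n. \<bar>kern i p\<bar>) \<le> (\<Sum>i\<in>{1..N} \<union> {N..n}. \<bar>kern i p\<bar>)"
      by (intro sum_mono2) auto
    also have "\<dots> \<le> (\<Sum>i=1..N. \<bar>kern i p\<bar>) + (\<Sum>i=N..n. \<bar>kern i p\<bar>)"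
      by (subst sum_Un) (auto intro!: sum_nonneg)
    also have "(\<Sum>i=N..n. \<bar>kern i p\<bar>) \<le> \<bar>step p * decay p N\<bar> * (\<Sum>i=N..n. decay N i)"
      unfolding sum_distrib_left
    proof (intro sum_mono)
      fix i assume i: "i \<in> {N..n}"
      then have "decay p i = decay p N * decay N i" using that by (intro decay_mult) auto
      then show "\<bar>kern i p\<bar> \<le> \<bar>step p * decay p N\<bar> * decay N i"
        using decay_N[of N i] by (simp add: kern_def abs_mult)
    qed
    also have "\<dots> \<le> \<bar>step p * decay p N\<bar> * (4 / step N)"
      using N by (intro mult_left_mono) auto
    finally show ?thesis by (simp add: B_def)
  qed
  have sB: "0 \<le> (\<Sum>p<N. B p)" using B by (intro sum_nonneg) auto
  have "(\<Sum>i=1..n. \<bar>kern i p\<bar>) \<le> 4 + (\<Sum>p<N. B p)" for p n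
  proof (cases "p < N")
    case True
    have "B p \<le> (\<Sum>p<N. B p)" using True B by (intro member_le_sum) auto
    then show ?thesis using little[OF True, of n] by linarith
  next
    case False
    then show ?thesis using big[of p n] sB by simp
  qed
  moreover have "0 < 4 + (\<Sum>p<N. B p)" using sB by simp
  ultimately show ?thesis by blast
qed

end

subsection \<open>Bias and variance of the batch-means estimator\<close>

locale sgd_batch_means = sgd_steps +
  fixes Ceta :: real
  assumes Ceta_gt: "Ceta > 1 / eta"
begin

lemma Ceta_pos: "Ceta > 0"
  using Ceta_gt eta_pos by (meson less_trans zero_less_divide_1_iff)

abbreviation len :: "nat \<Rightarrow> nat" where
  "len \<equiv> batch_len Ceta alpha"

text \<open>The matrix of batch weights: 2 off the diagonal inside the batch and 1 on the diagonal.
  For an empty batch, such as at \<open>i = 1\<close>, the diagonal weight is -1.\<close>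

definition wt :: "nat \<Rightarrow> nat \<Rightarrow> real" where
  "wt i k = (if k \<le> i then (if i < k + len i then 2 else 0) - (if k = i then 1 else 0) else 0)"

definition qmat :: "nat \<Rightarrow> nat \<Rightarrow> nat \<Rightarrow> real" where
  "qmat n p q = (\<Sum>i=1..n. \<Sum>k=1..n. wt i k * kern i p * kern k q) / real n"

section \<open>The estimator as a quadratic form in the noise\<close>

lemma sgd_iter_eq_padded:
  assumes "i \<le> n"
  shows "sgd_iter eta alpha xi i = (\<Sum>p=1..n. kern i p * xi p)"
  unfolding sgd_iter_eq using assms by (intro sum.mono_neutral_left) (auto simp: kern_eq_0)

lemma sum_wt:
  assumes "1 \<le> i" "i \<le> n"
  shows "(\<Sum>k=1..n. wt i k * f k) = 2 * (\<Sum>k\<in>{k. 1 \<le> k \<and> k \<le> i \<and> i < k + len i}. f k) - f i"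
proof -
  have "(\<Sum>k=1..n. wt i k * f k) = (\<Sum>k=1..i. wt i k * f k)"
    using assms by (intro sum.mono_neutral_right) (auto simp: wt_def)
  also have "\<dots> = (\<Sum>k=1..i. 2 * (if i < k + len i then f k else 0) - (if k = i then f k else 0))"
    by (intro sum.cong) (auto simp: wt_def)
  also have "\<dots> = 2 * (\<Sum>k=1..i. if i < k + len i then f k else 0) - f i"
    using assms by (simp add: sum_subtractf sum_distrib_left)
  also have "(\<Sum>k=1..i. if i < k + len i then f k else 0) = (\<Sum>k\<in>{k\<in>{1..i}. i < k + len i}. f k)"
    by (subst sum.inter_filter) auto
  also have "{k\<in>{1..i}. i < k + len i} = {k. 1 \<le> k \<and> k \<le> i \<and> i < k + len i}" by auto
  finally show ?thesis .
qed

lemma sigma_hat_eq: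
  "sigma_hat eta alpha Ceta xi n = (\<Sum>p=1..n. \<Sum>q=1..n. qmat n p q * (xi p * xi q))"
proof -
  define x where "x = sgd_iter eta alpha xi"
  have "sigma_hat eta alpha Ceta xi n = (\<Sum>i=1..n. \<Sum>k=1..n. wt i k * x i * x k) / real n"
  proof -
    have "2 * x i * (\<Sum>k\<in>{k. 1 \<le> k \<and> k \<le> i \<and> i < k + len i}. x k) - (x i)\<^sup>2 = (\<Sum>k=1..n. wt i k * x i * x k)"
      if "i \<in> {1..n}" for i
    proof -
      have "(\<Sum>k=1..n. wt i k * x i * x k) = x i * (\<Sum>k=1..n. wt i k * x k)"
        by (simp add: sum_distrib_left mult_ac)
      also have "(\<Sum>k=1..n. wt i k * x k) = 2 * (\<Sum>k\<in>{k. 1 \<le> k \<and> k \<le> i \<and> i < k + len i}. x k) - x i"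
        using that by (intro sum_wt) auto
      finally show ?thesis by (simp add: power2_eq_square right_diff_distrib)
    qed
    then show ?thesis by (simp add: sigma_hat_def x_def[symmetric])
  qed
  also have "(\<Sum>i=1..n. \<Sum>k=1..n. wt i k * x i * x k)
      = (\<Sum>i=1..n. \<Sum>k=1..n. wt i k * (\<Sum>p=1..n. kern i p * xi p) * (\<Sum>q=1..n. kern k q * xi q))"
    by (intro sum.cong refl) (auto simp: x_def sgd_iter_eq_padded[of _ n])
  also have "\<dots> = (\<Sum>i=1..n. \<Sum>k=1..n. \<Sum>p=1..n. \<Sum>q=1..n. wt i k * kern i p * kern k q * (xi p * xi q))"
    unfolding mult.assoc sum_product unfolding sum_distrib_left by (simp add: mult_ac)
  also have "\<dots> = (\<Sum>i=1..n. \<Sum>p=1..n. \<Sum>q=1..n. \<Sum>k=1..n. wt i k * kern i p * kern k q * (xi p * xi q))"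
    by (rule sum.cong[OF refl], subst sum.swap, rule sum.cong[OF refl], rule sum.swap)
  also have "\<dots> = (\<Sum>p=1..n. \<Sum>q=1..n. \<Sum>i=1..n. \<Sum>k=1..n. wt i k * kern i p * kern k q * (xi p * xi q))"
    by (subst sum.swap, rule sum.cong[OF refl], rule sum.swap)
  finally show ?thesis
    by (simp add: qmat_def sum_divide_distrib sum_distrib_right)
qed

text \<open>The mean squared error divided by the squared noise variance, in the form delivered by
  \<open>gaussian_quadratic_form_mse\<close>.\<close>

definition mse_coeff :: "nat \<Rightarrow> real" where
  "mse_coeff n = ((\<Sum>p=1..n. qmat n p p) - 1)\<^sup>2 + (\<Sum>p=1..n. \<Sum>q=1..n. (qmat n p q + qmat n q p)\<^sup>2) / 2"

text \<open>If the symmetrised matrix vanishes then so does the trace, and the bias term equals 1.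
  Positivity at every \<open>n\<close> lets an eventual lower bound be extended to all
  \<open>n \<ge> 2\<close>.\<close>

lemma mse_coeff_pos: "0 < mse_coeff n"
proof (rule ccontr)
  assume "\<not> 0 < mse_coeff n"
  moreover have nn: "0 \<le> (\<Sum>q=1..n. (qmat n p q + qmat n q p)\<^sup>2)" for p by (intro sum_nonneg) auto
  then have "0 \<le> (\<Sum>p=1..n. \<Sum>q=1..n. (qmat n p q + qmat n q p)\<^sup>2)" by (intro sum_nonneg) auto
  ultimately have 0: "((\<Sum>p=1..n. qmat n p p) - 1)\<^sup>2 = 0" "(\<Sum>p=1..n. \<Sum>q=1..n. (qmat n p q + qmat n q p)\<^sup>2) = 0"
    using zero_le_power2[of "(\<Sum>p=1..n. qmat n p p) - 1"] unfolding mse_coeff_def by linarith+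
  have "qmat n p p = 0" if "p \<in> {1..n}" for p
  proof -
    have "(\<Sum>q=1..n. (qmat n p q + qmat n q p)\<^sup>2) = 0"
      using 0(2) nn that by (subst (asm) sum_nonneg_eq_0_iff) auto
    then have "(qmat n p p + qmat n p p)\<^sup>2 = 0"
      using that by (subst (asm) sum_nonneg_eq_0_iff) auto
    then show ?thesis by simp
  qed
  then show False using 0(1) by simp
qed

section \<open>Upper bound for the Frobenius norm\<close>

lemma len_le: "i \<ge> 1 \<Longrightarrow> real (len i) \<le> Ceta * real i powr alpha * ln (real i)"
  using Ceta_pos by (auto simp: batch_len_def intro!: of_nat_floor mult_nonneg_nonneg)

lemma len_ge: "Ceta * real i powr alpha * ln (real i) - 1 \<le> real (len i)"
  unfolding batch_len_def by linarith

lemma wt_sum_squares_le: "(\<Sum>k=1..n. (wt i k)\<^sup>2) \<le> 4 * (real (len i) + 1)"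
proof -
  have "(\<Sum>k=1..n. (wt i k)\<^sup>2) \<le> (\<Sum>k\<in>{1..n}. if k \<in> {i - len i..i} then 4 else 0)"
    by (intro sum_mono) (auto simp: wt_def)
  also have "\<dots> = (\<Sum>k\<in>{1..n} \<inter> {i - len i..i}. 4)"
    by (subst sum.inter_restrict) auto
  also have "\<dots> \<le> (\<Sum>k\<in>{i - len i..i}. 4)"
    by (intro sum_mono2) auto
  also have "\<dots> = 4 * real (card {i - len i..i})" by simp
  also have "\<dots> \<le> 4 * (real (len i) + 1)" by simp
  finally show ?thesis .
qed

lemma qmat_frobenius_le:
  "\<exists>C>0. \<forall>n\<ge>2. (\<Sum>p=1..n. \<Sum>q=1..n. (qmat n p q)\<^sup>2) \<le> C * (real n powr (alpha - 1) * ln (real n))"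
proof -
  obtain K1 where K1: "K1 > 0" "\<And>i. (\<Sum>p=1..i. \<bar>kern i p\<bar>) \<le> K1" using kern_row_sum_bounded by auto
  obtain K2 where K2: "K2 > 0" "\<And>p n. (\<Sum>i=1..n. \<bar>kern i p\<bar>) \<le> K2" using kern_column_sum_bounded by auto
  define K where "K = max K1 K2"
  have K: "K > 0" "K \<ge> K1" "K \<ge> K2" using K1 by (auto simp: K_def)
  \<comment> \<open>The summand \<open>1 / ln 2\<close> absorbs the \<open>+ 1\<close> from the
    window count, since \<open>n powr alpha * ln n\<close> is at least \<open>ln 2\<close> for
    \<open>n \<ge> 2\<close>.\<close>
  define D where "D = Ceta + 1 / ln 2"
  have D: "D > 0" using Ceta_pos by (auto simp: D_def intro: add_pos_pos)
  have "(\<Sum>p=1..n. \<Sum>q=1..n. (qmat n p q)\<^sup>2) \<le> 4 * K ^ 4 * D * (real n powr (alpha - 1) * ln (real n))" if n: "n \<ge> 2" for n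
  proof -
    have row: "(\<Sum>p=1..n. \<bar>kern i p\<bar>) \<le> K" if "i \<in> {1..n}" for i
    proof -
      have "(\<Sum>p=1..n. \<bar>kern i p\<bar>) = (\<Sum>p=1..i. \<bar>kern i p\<bar>)"
        using that by (intro sum.mono_neutral_right) (auto simp: kern_eq_0)
      then show ?thesis using K1(2)[of i] K by simp
    qed
    have col: "(\<Sum>i=1..n. \<bar>kern i p\<bar>) \<le> K" for p
      using K2(2)[where n=n and p=p] K by simp
    have "(\<Sum>p=1..n. \<Sum>q=1..n. (qmat n p q)\<^sup>2) = (\<Sum>p=1..n. \<Sum>q=1..n. (\<Sum>i=1..n. \<Sum>k=1..n. wt i k * kern i p * kern k q)\<^sup>2) / (real n)\<^sup>2"
      by (simp add: qmat_def power_divide flip: sum_divide_distrib)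
    also have "\<dots> \<le> K ^ 4 * (\<Sum>i=1..n. \<Sum>k=1..n. (wt i k)\<^sup>2) / (real n)\<^sup>2"
      using K by (intro divide_right_mono schur_test_congruence row col) auto
    also have "\<dots> \<le> K ^ 4 * (\<Sum>i=1..n. 4 * (D * (real n powr alpha * ln (real n)))) / (real n)\<^sup>2"
    proof (intro divide_right_mono mult_left_mono sum_mono)
      fix i assume i: "i \<in> {1..n}"
      have "real i powr alpha * ln (real i) \<le> real n powr alpha * ln (real n)"
        using i alpha_gt by (intro mult_mono powr_mono2) auto
      then have "Ceta * (real i powr alpha * ln (real i)) \<le> Ceta * (real n powr alpha * ln (real n))"
        using Ceta_pos by (intro mult_left_mono) auto
      moreover have "1 * ln 2 \<le> real n powr alpha * ln (real n)"
        using n alpha_gt by (intro mult_mono ge_one_powr_ge_zero) auto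
      then have "1 \<le> 1 / ln 2 * (real n powr alpha * ln (real n))"
        by (simp add: field_simps)
      moreover have "real (len i) \<le> Ceta * (real i powr alpha * ln (real i))"
        using len_le[of i] i by (simp add: mult.assoc)
      ultimately have "real (len i) + 1 \<le> D * (real n powr alpha * ln (real n))"
        unfolding D_def distrib_right by linarith
      then show "(\<Sum>k=1..n. (wt i k)\<^sup>2) \<le> 4 * (D * (real n powr alpha * ln (real n)))"
        by (intro order_trans[OF wt_sum_squares_le] mult_left_mono) auto
    qed auto
    also have "\<dots> = 4 * K ^ 4 * D * (real n powr alpha / real n * ln (real n))"
      using n by (simp add: power2_eq_square)
    also have "real n powr alpha / real n = real n powr (alpha - 1)"
      using n by (simp add: powr_diff)
    finally show ?thesis .
  qed
  moreover have "4 * K ^ 4 * D > 0" using K D by simp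
  ultimately show ?thesis by blast
qed

section \<open>Bias: covariances truncated to the batch\<close>

lemma cov_window:
  assumes "1 \<le> i"
  shows "(\<Sum>k=1..i. wt i k * (decay k i * nvar k)) = 2 * (cumcov i - decay (i - len i) i * cumcov (i - len i)) - nvar i"
proof -
  \<comment> \<open>Everything before the batch factors through time \<open>i - len i\<close>. If
    the batch reaches past the start, truncated subtraction gives 0 and both sides vanish.\<close>
  have "(\<Sum>k=1..i - len i. decay k i * nvar k) = decay (i - len i) i * cumcov (i - len i)"
    unfolding cumcov_def sum_distrib_left
  proof (rule sum.cong[OF refl])
    fix k assume "k \<in> {1..i - len i}"
    then have "decay k i = decay k (i - len i) * decay (i - len i) i" by (intro decay_mult) auto
    then show "decay k i * nvar k = decay (i - len i) i * (decay k (i - len i) * nvar k)" by simp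
  qed
  moreover have "cumcov i = (\<Sum>k=1..i - len i. decay k i * nvar k) + (\<Sum>k\<in>{k. 1 \<le> k \<and> k \<le> i \<and> i < k + len i}. decay k i * nvar k)"
  proof -
    have "{1..i} = {1..i - len i} \<union> {k. 1 \<le> k \<and> k \<le> i \<and> i < k + len i}" by auto
    then show ?thesis unfolding cumcov_def by (subst sum.union_disjoint[symmetric]) auto
  qed
  ultimately show ?thesis
    using sum_wt[of i i "\<lambda>k. decay k i * nvar k"] assms by simp
qed

text \<open>Cyclicity of the trace: exchanging the sums pairs the weights with the covariances of
  the iterates, which \<open>kern_cov\<close> evaluates.\<close>

lemma qmat_trace: "(\<Sum>p=1..n. qmat n p p) = (\<Sum>i=1..n. \<Sum>k=1..i. wt i k * (decay k i * nvar k)) / real n"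
proof -
  have "(\<Sum>p=1..n. \<Sum>i=1..n. \<Sum>k=1..n. wt i k * kern i p * kern k p)
      = (\<Sum>i=1..n. \<Sum>k=1..n. \<Sum>p=1..n. wt i k * kern i p * kern k p)"
    by (subst sum.swap, rule sum.cong[OF refl], rule sum.swap)
  also have "\<dots> = (\<Sum>i=1..n. \<Sum>k=1..i. wt i k * (decay k i * nvar k))"
  proof (rule sum.cong[OF refl])
    fix i assume i: "i \<in> {1..n}"
    have "(\<Sum>k=1..n. \<Sum>p=1..n. wt i k * kern i p * kern k p) = (\<Sum>k=1..i. \<Sum>p=1..n. wt i k * kern i p * kern k p)"
      using i by (intro sum.mono_neutral_right) (auto simp: wt_def)
    also have "\<dots> = (\<Sum>k=1..i. wt i k * (decay k i * nvar k))"
    proof (rule sum.cong[OF refl])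
      fix k assume k: "k \<in> {1..i}"
      have "(\<Sum>p=1..n. wt i k * kern i p * kern k p) = wt i k * (\<Sum>p=1..n. kern i p * kern k p)"
        by (simp add: sum_distrib_left mult.assoc)
      also have "\<dots> = wt i k * (decay k i * nvar k)"
        using i k by (subst kern_cov) auto
      finally show "(\<Sum>p=1..n. wt i k * kern i p * kern k p) = wt i k * (decay k i * nvar k)" .
    qed
    finally show "(\<Sum>k=1..n. \<Sum>p=1..n. wt i k * kern i p * kern k p) = (\<Sum>k=1..i. wt i k * (decay k i * nvar k))" .
  qed
  finally show ?thesis by (simp add: qmat_def sum_divide_distrib[symmetric])
qed

text \<open>Each factor in the window is at most \<open>exp (- step i)\<close>, and
  \<open>len i * step i\<close> is at least \<open>ln i - 1\<close> because
  \<open>Ceta * eta > 1\<close>. The constant \<open>exp 1\<close> pays for the rounding in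
  \<open>batch_len\<close>, which costs at most one step.\<close>

lemma decay_window_le:
  assumes "1 \<le> i" "len i \<le> i" "\<And>k. k \<ge> i - len i \<Longrightarrow> step k \<le> 1"
  shows "decay (i - len i) i \<le> exp 1 / real i"
proof -
  have "decay (i - len i) i \<le> (\<Prod>k\<in>{i - len i<..i}. exp (- step i))"
    unfolding decay_def
  proof (intro prod_mono conjI)
    fix k assume k: "k \<in> {i - len i<..i}"
    show "0 \<le> 1 - step k" using assms k by auto
    have "step i \<le> step k" using k by (intro step_antimono) auto
    then show "1 - step k \<le> exp (- step i)"
      using exp_ge_add_one_self[of "- step i"] by linarith
  qed
  also have "\<dots> = exp (- (real (len i) * step i))"
    using assms by (simp add: exp_of_nat_mult[symmetric])
  also have "\<dots> \<le> exp (1 - ln (real i))"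
  proof -
    have st: "step i \<le> 1" using assms(3)[of i] by simp
    have "ln (real i) \<le> Ceta * eta * ln (real i)"
      using Ceta_gt eta_pos assms(1) mult_right_mono[of 1 "Ceta * eta" "ln (real i)"] by (simp add: field_simps)
    also have "\<dots> = (Ceta * real i powr alpha * ln (real i)) * step i"
      using assms(1) by (simp add: step_def powr_minus)
    also have "\<dots> \<le> (real (len i) + 1) * step i"
      using len_ge[of i] step_nonneg[of i] by (intro mult_right_mono) auto
    finally show ?thesis using st by (simp add: algebra_simps)
  qed
  also have "\<dots> = exp 1 / real i" using assms(1) by (simp add: exp_diff)
  finally show ?thesis .
qed

text \<open>Twice the limit \<open>1/2\<close> of \<open>cumcov\<close> gives 1. Three errors
  remain: the deviation of \<open>cumcov\<close>, the truncated tail of order \<open>1 / i\<close>,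
  and \<open>nvar\<close> of order \<open>i powr (- alpha)\<close>; each is dominated by the stated
  power.\<close>

lemma cov_window_asymp:
  "\<exists>C>0. \<forall>i\<ge>1. \<bar>(\<Sum>k=1..i. wt i k * (decay k i * nvar k)) - 1\<bar> \<le> C * real i powr (- ((1 - alpha) / 2))"
proof -
  obtain C1 where C1: "C1 > 0" "\<And>i. i \<ge> 1 \<Longrightarrow> \<bar>nvar i - step i / 2\<bar> \<le> C1 * real i powr (- ((1 + alpha) / 2))"
    using nvar_asymp by auto
  obtain C2 where C2: "C2 > 0" "\<And>i. i \<ge> 1 \<Longrightarrow> \<bar>cumcov i - 1 / 2\<bar> \<le> C2 * real i powr (- ((1 - alpha) / 2))"
    using cumcov_asymp by auto
  obtain N where N: "\<And>k. k \<ge> N \<Longrightarrow> step k \<le> 1"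
    using eventually_step_le[of 1] unfolding eventually_sequentially by auto
  \<comment> \<open>Since \<open>alpha < 1\<close>, the batch eventually fills at most half of the
    past, so it starts beyond \<open>N\<close>, where all factors of \<open>decay\<close> are
    nonnegative.\<close>
  have "eventually (\<lambda>i. Ceta * real i powr alpha * ln (real i) \<le> real i / 2) sequentially"
    using alpha_lt Ceta_pos alpha_gt by real_asymp
  then have ev: "eventually (\<lambda>i. \<bar>(\<Sum>k=1..i. wt i k * (decay k i * nvar k)) - 1\<bar>
      \<le> (2 * C2 + 2 * exp 1 * (1 / 2 + C2) + eta / 2 + C1) * real i powr (- ((1 - alpha) / 2))) sequentially"
    using eventually_ge_at_top[of "2 * (N + 1)"]
  proof eventually_elim
    case (elim i)
    define r where "r = real i powr (- ((1 - alpha) / 2))"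
    define j where "j = i - len i"
    have i: "i \<ge> 1" using elim by auto
    have "real (len i) \<le> real i / 2" using len_le[OF i] elim by linarith
    then have li: "2 * len i \<le> i" by linarith
    have j: "j \<ge> N" "j \<ge> 1" using li elim by (auto simp: j_def)
    have "r \<ge> 0" by (simp add: r_def)
    have d: "0 \<le> decay j i" using N j by (intro decay_nonneg) auto
    have "decay j i \<le> exp 1 / real i"
      unfolding j_def using i li N j by (intro decay_window_le) (auto simp: j_def)
    also have "1 / real i \<le> r"
    proof -
      have "real i powr (-1) \<le> r" unfolding r_def using i alpha_gt by (intro powr_mono) auto
      then show ?thesis using i by (simp add: powr_minus_divide)
    qed
    then have "exp 1 / real i \<le> exp 1 * r" using mult_left_mono[of "1 / real i" r "exp 1"] by simp
    finally have d': "decay j i \<le> exp 1 * r" .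
    have "real j powr (- ((1 - alpha) / 2)) \<le> 1"
      using j alpha_lt powr_mono2'[of "- ((1 - alpha) / 2)" 1 "real j"] by simp
    then have "C2 * real j powr (- ((1 - alpha) / 2)) \<le> C2 * 1" using C2 by (intro mult_left_mono) auto
    then have "\<bar>cumcov j\<bar> \<le> 1 / 2 + C2" using C2(2)[OF j(2)] by linarith
    then have tail: "\<bar>decay j i * cumcov j\<bar> \<le> exp 1 * r * (1 / 2 + C2)"
      unfolding abs_mult using d d' by (intro mult_mono) auto
    have "real i powr (- ((1 + alpha) / 2)) \<le> r"
      unfolding r_def using i alpha_gt by (intro powr_mono) auto
    then have nv: "\<bar>nvar i - step i / 2\<bar> \<le> C1 * r"
      using C1 by (intro order_trans[OF C1(2)[OF i]] mult_left_mono) auto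
    have "real i powr (- alpha) \<le> r"
      unfolding r_def using i alpha_gt by (intro powr_mono) auto
    then have st: "step i / 2 \<le> eta / 2 * r" "0 \<le> step i" using eta_pos by (auto simp: step_def)
    have cc: "\<bar>cumcov i - 1 / 2\<bar> \<le> C2 * r" using C2(2)[OF i] by (simp add: r_def)
    have aux: "\<bar>2 * (c - t) - v - 1\<bar> \<le> 2 * \<bar>c - 1 / 2\<bar> + 2 * \<bar>t\<bar> + \<bar>v - s / 2\<bar> + s / 2" if "0 \<le> s" for c t v s :: real
    proof -
      have "\<bar>2 * (c - t) - v - 1\<bar> = \<bar>2 * (c - 1 / 2) + (- (2 * t)) + (- (v - s / 2)) + (- (s / 2))\<bar>"
        by (simp add: algebra_simps)
      also have "\<dots> \<le> \<bar>2 * (c - 1 / 2)\<bar> + \<bar>- (2 * t)\<bar> + \<bar>- (v - s / 2)\<bar> + \<bar>- (s / 2)\<bar>"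
        by (intro order_trans[OF abs_triangle_ineq] add_mono order_refl)
      finally show ?thesis unfolding abs_mult abs_minus_cancel using that by simp
    qed
    have "\<bar>(\<Sum>k=1..i. wt i k * (decay k i * nvar k)) - 1\<bar> \<le> 2 * \<bar>cumcov i - 1 / 2\<bar> + 2 * \<bar>decay j i * cumcov j\<bar> + \<bar>nvar i - step i / 2\<bar> + step i / 2"
      unfolding cov_window[OF i] j_def[symmetric] by (rule aux[OF st(2)])
    also have "\<dots> \<le> 2 * (C2 * r) + 2 * (exp 1 * r * (1 / 2 + C2)) + C1 * r + eta / 2 * r"
      using cc tail nv st by (intro add_mono mult_left_mono) auto
    finally show ?case by (simp add: r_def algebra_simps)
  qed
  show ?thesis by (rule eventually_le_imp_uniform_le[OF ev]) auto
qed

text \<open>Averaging the errors of order \<open>i powr (- ((1 - alpha) / 2))\<close> preserves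
  their order, and squaring gives \<open>n powr (alpha - 1)\<close>. The logarithm is inserted only
  to match the target rate, at the price of \<open>1 / ln 2\<close>.\<close>

lemma bias_le:
  "\<exists>C>0. \<forall>n\<ge>2. ((\<Sum>p=1..n. qmat n p p) - 1)\<^sup>2 \<le> C * (real n powr (alpha - 1) * ln (real n))"
proof -
  obtain C where C: "C > 0" "\<And>i. i \<ge> 1 \<Longrightarrow> \<bar>(\<Sum>k=1..i. wt i k * (decay k i * nvar k)) - 1\<bar> \<le> C * real i powr (- ((1 - alpha) / 2))"
    using cov_window_asymp by auto
  have "((\<Sum>p=1..n. qmat n p p) - 1)\<^sup>2 \<le> (4 * C\<^sup>2 / ln 2) * (real n powr (alpha - 1) * ln (real n))" if n: "n \<ge> 2" for n
  proof -
    define h where "h i = (\<Sum>k=1..i. wt i k * (decay k i * nvar k))" for i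
    have "\<bar>(\<Sum>p=1..n. qmat n p p) - 1\<bar> = \<bar>\<Sum>i=1..n. h i - 1\<bar> / real n"
      unfolding qmat_trace h_def[symmetric] using n by (simp add: sum_subtractf field_simps abs_divide[symmetric])
    also have "\<dots> \<le> (\<Sum>i=1..n. C * real i powr ((1 + alpha) / 2 - 1)) / real n"
    proof (intro divide_right_mono order_trans[OF sum_abs] sum_mono)
      fix i assume i: "i \<in> {1..n}"
      have e: "(1 + alpha) / 2 - 1 = - ((1 - alpha) / 2)" by (simp add: field_simps)
      show "\<bar>h i - 1\<bar> \<le> C * real i powr ((1 + alpha) / 2 - 1)"
        unfolding e h_def using C(2)[of i] i by auto
    qed auto
    also have "\<dots> \<le> C * (2 * real n powr ((1 + alpha) / 2)) / real n"
      unfolding sum_distrib_left[symmetric] using C alpha_gt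
      by (intro divide_right_mono mult_left_mono sum_powr_le) auto
    also have "\<dots> = 2 * C * real n powr ((alpha - 1) / 2)"
    proof -
      have "(alpha - 1) / 2 = (1 + alpha) / 2 - 1" by (simp add: field_simps)
      then show ?thesis using n by (simp only: powr_diff) simp
    qed
    finally have "\<bar>(\<Sum>p=1..n. qmat n p p) - 1\<bar>\<^sup>2 \<le> (2 * C * real n powr ((alpha - 1) / 2))\<^sup>2"
      by (intro power_mono) auto
    also have "\<dots> = 4 * C\<^sup>2 * real n powr (alpha - 1)"
      by (simp add: power_mult_distrib power2_eq_square flip: powr_add)
    also have "\<dots> = (4 * C\<^sup>2 / ln 2) * (real n powr (alpha - 1) * ln 2)" by simp
    also have "\<dots> \<le> (4 * C\<^sup>2 / ln 2) * (real n powr (alpha - 1) * ln (real n))"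
      using n by (intro mult_left_mono) auto
    finally show ?thesis by simp
  qed
  moreover have "4 * C\<^sup>2 / ln 2 > 0" using C by simp
  ultimately show ?thesis by blast
qed

section \<open>Upper bound for the normalised mean squared error\<close>

lemma mse_coeff_le: "\<exists>C>0. \<forall>n\<ge>2. mse_coeff n \<le> C * (real n powr (alpha - 1) * ln (real n))"
proof -
  obtain C1 where C1: "C1 > 0" "\<And>n. n \<ge> 2 \<Longrightarrow> ((\<Sum>p=1..n. qmat n p p) - 1)\<^sup>2 \<le> C1 * (real n powr (alpha - 1) * ln (real n))"
    using bias_le by auto
  obtain C2 where C2: "C2 > 0" "\<And>n. n \<ge> 2 \<Longrightarrow> (\<Sum>p=1..n. \<Sum>q=1..n. (qmat n p q)\<^sup>2) \<le> C2 * (real n powr (alpha - 1) * ln (real n))"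
    using qmat_frobenius_le by auto
  have "mse_coeff n \<le> (C1 + 2 * C2) * (real n powr (alpha - 1) * ln (real n))" if n: "n \<ge> 2" for n
  proof -
    have "(\<Sum>p=1..n. \<Sum>q=1..n. (qmat n p q + qmat n q p)\<^sup>2) \<le> (\<Sum>p=1..n. \<Sum>q=1..n. 2 * (qmat n p q)\<^sup>2 + 2 * (qmat n q p)\<^sup>2)"
    proof (intro sum_mono)
      fix p q
      have "0 \<le> (qmat n p q - qmat n q p)\<^sup>2" by simp
      then show "(qmat n p q + qmat n q p)\<^sup>2 \<le> 2 * (qmat n p q)\<^sup>2 + 2 * (qmat n q p)\<^sup>2"
        by (simp add: power2_eq_square algebra_simps)
    qed
    also have "\<dots> = 2 * (\<Sum>p=1..n. \<Sum>q=1..n. (qmat n p q)\<^sup>2) + 2 * (\<Sum>p=1..n. \<Sum>q=1..n. (qmat n q p)\<^sup>2)"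
      by (simp add: sum.distrib sum_distrib_left)
    also have "(\<Sum>p=1..n. \<Sum>q=1..n. (qmat n q p)\<^sup>2) = (\<Sum>p=1..n. \<Sum>q=1..n. (qmat n p q)\<^sup>2)"
      by (rule sum.swap)
    finally have "(\<Sum>p=1..n. \<Sum>q=1..n. (qmat n p q + qmat n q p)\<^sup>2) / 2 \<le> 2 * (\<Sum>p=1..n. \<Sum>q=1..n. (qmat n p q)\<^sup>2)"
      by simp
    then show ?thesis
      using C1(2)[OF n] C2(2)[OF n] by (simp add: mse_coeff_def algebra_simps)
  qed
  then show ?thesis using C1 C2 by (intro exI[of _ "C1 + 2 * C2"]) auto
qed

section \<open>Lower bound from a band of large matrix entries\<close>

lemma kern_nonneg:
  assumes "\<And>k. k > p \<Longrightarrow> step k \<le> 1"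
  shows "0 \<le> kern i p"
  using decay_nonneg[OF assms] step_nonneg by (simp add: kern_def)

text \<open>By Bernoulli's inequality, \<open>m\<close> factors of at least
  \<open>1 - step h\<close> with \<open>m * step h \<le> 1/2\<close> retain at least half of the
  weight \<open>step p\<close>, which is at least \<open>step n\<close>.\<close>

lemma kern_ge:
  assumes h: "1 \<le> h" "h \<le> p" and i: "p \<le> i" "i \<le> p + m" "i \<le> n" and st: "real m * step h \<le> 1 / 2" "step h \<le> 1"
  shows "step n / 2 \<le> kern i p"
proof -
  have "1 / 2 \<le> 1 + real (i - p) * (- step h)"
  proof -
    have "real (i - p) * step h \<le> real m * step h"
      using i step_nonneg by (intro mult_right_mono) auto
    then show ?thesis using st by simp
  qed
  also have "\<dots> \<le> (1 + (- step h)) ^ (i - p)"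
    using st by (intro Bernoulli_inequality) auto
  also have "\<dots> = (\<Prod>k\<in>{p<..i}. 1 - step h)" by simp
  also have "\<dots> \<le> decay p i"
    unfolding decay_def using h st step_antimono[of h] by (intro prod_mono) auto
  finally have d: "1 / 2 \<le> decay p i" .
  have "step n * (1 / 2) \<le> step p * decay p i"
    using d h i step_nonneg step_antimono[of p n] by (intro mult_mono) auto
  then show ?thesis using h i by (simp add: kern_def)
qed

text \<open>The negative diagonal weight of an empty batch could occur only for
  \<open>i < p\<close>, where \<open>kern i p\<close> vanishes; all remaining factors are
  nonnegative.\<close>

lemma qmat_nonneg:
  assumes "\<And>k. k \<ge> N \<Longrightarrow> step k \<le> 1" "\<And>k. k \<ge> N \<Longrightarrow> 1 \<le> len k" "N \<le> p" "N \<le> q"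
  shows "0 \<le> qmat n p q"
proof -
  have "0 \<le> wt i k * kern i p * kern k q" for i k
  proof (cases "p \<le> i")
    case True
    then have "1 \<le> len i" using assms by auto
    then have "0 \<le> wt i k" by (auto simp: wt_def)
    then show ?thesis using assms by (intro mult_nonneg_nonneg kern_nonneg) auto
  qed (auto simp: kern_eq_0)
  then show ?thesis unfolding qmat_def by (intro divide_nonneg_nonneg sum_nonneg) auto
qed

text \<open>By nonnegativity only the \<open>m\<close> by \<open>m\<close> block of iterates just
  after \<open>p\<close> and \<open>q\<close> is kept. There both kernels are at least
  \<open>step n / 2\<close> and the weight is 2.\<close>

lemma qmat_ge:
  assumes N: "\<And>k. k \<ge> h \<Longrightarrow> step k \<le> 1" "\<And>k. k \<ge> h \<Longrightarrow> R + m \<le> len k" "\<And>k. k \<ge> h \<Longrightarrow> 1 \<le> len k"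
    and h: "1 \<le> h" "h \<le> q" and pq: "q + m \<le> p" "p \<le> q + R" "p + m \<le> n"
    and st: "real m * step h \<le> 1 / 2"
  shows "(real m * step n)\<^sup>2 / (2 * real n) \<le> qmat n p q"
proof -
  have hp: "h \<le> p" using h pq by auto
  have kn: "0 \<le> kern i p" "0 \<le> kern i q" for i using N h hp by (auto intro!: kern_nonneg)
  have wn: "0 \<le> wt i k * kern i p" for i k
  proof (cases "p \<le> i")
    case True
    then have "1 \<le> len i" using N hp by auto
    then have "0 \<le> wt i k" by (auto simp: wt_def)
    then show ?thesis using kn by auto
  qed (auto simp: kern_eq_0)
  have wkk: "0 \<le> wt i k * kern i p * kern k q" for i k using wn kn by auto
  have "(real m * step n)\<^sup>2 / 2 = (\<Sum>i\<in>{p..<p + m}. \<Sum>k\<in>{q..<q + m}. 2 * (step n / 2) * (step n / 2))"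
    by (simp add: power2_eq_square)
  also have "\<dots> \<le> (\<Sum>i\<in>{p..<p + m}. \<Sum>k\<in>{q..<q + m}. wt i k * kern i p * kern k q)"
  proof (intro sum_mono)
    fix i k assume ik: "i \<in> {p..<p + m}" "k \<in> {q..<q + m}"
    have "R + m \<le> len i" using N ik hp by auto
    \<comment> \<open>\<open>q + m \<le> p\<close> keeps the block off the diagonal, and
      \<open>p \<le> q + R\<close> with \<open>R + m \<le> len i\<close> keeps it inside the
      batch.\<close>
    then have w: "wt i k = 2" using ik pq by (auto simp: wt_def)
    have "step n / 2 \<le> kern i p"
      by (rule kern_ge[of h _ _ m]) (use h hp ik pq st N in auto)
    moreover have "step n / 2 \<le> kern k q"
      by (rule kern_ge[of h _ _ m]) (use h hp ik pq st N in auto)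
    ultimately show "2 * (step n / 2) * (step n / 2) \<le> wt i k * kern i p * kern k q"
      unfolding w using step_nonneg[of n] kn by (intro mult_mono) auto
  qed
  also have "\<dots> \<le> (\<Sum>i\<in>{p..<p + m}. \<Sum>k=1..n. wt i k * kern i p * kern k q)"
    using h pq by (intro sum_mono sum_mono2 wkk) auto
  also have "\<dots> \<le> (\<Sum>i=1..n. \<Sum>k=1..n. wt i k * kern i p * kern k q)"
    using h hp pq by (intro sum_mono2 sum_nonneg wkk) auto
  finally have "(real m * step n)\<^sup>2 / 2 / real n \<le> qmat n p q"
    unfolding qmat_def by (intro divide_right_mono) auto
  then show ?thesis by simp
qed

text \<open>About \<open>n\<close> rows, each with about \<open>n powr alpha * ln n\<close> columns,
  carry entries of order \<open>1 / n\<close>; summing their squares gives the rate.\<close>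

lemma mse_coeff_ge:
  "\<exists>C. eventually (\<lambda>n. real n powr (alpha - 1) * ln (real n) \<le> C * mse_coeff n) sequentially"
proof -
  text \<open>Over \<open>eps * n powr alpha\<close> steps the kernel loses at most half of its mass, since
    \<open>step (n div 2) \<le> 3 * eta * n powr - alpha\<close>.\<close>
  define eps where "eps = 1 / (6 * eta)"
  \<comment> \<open>For \<open>k \<ge> n div 2\<close> the batch bound loses a factor 3 from the
    power and 2 from the logarithm, so \<open>len k\<close> is at least \<open>2 * L n - 1\<close>,
    which leaves room for \<open>R + m\<close>.\<close>
  define rho where "rho = Ceta / 12"
  have pos: "eps > 0" "rho > 0" using eta_pos Ceta_pos by (auto simp: eps_def rho_def)
  define E where "E n = eps * real n powr alpha" for n
  define L where "L n = rho * (real n powr alpha * ln (real n))" for n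
  have "eventually (\<lambda>k. step k \<le> 1) sequentially"
    by (rule eventually_step_le) auto
  moreover have "eventually (\<lambda>k. 2 \<le> Ceta * real k powr alpha * ln (real k)) sequentially"
    using alpha_gt Ceta_pos by real_asymp
  ultimately have "eventually (\<lambda>k. step k \<le> 1 \<and> 1 \<le> len k) sequentially"
  proof eventually_elim
    case (elim k)
    then show ?case using len_ge[of k] by linarith
  qed
  then obtain N where N: "\<And>k. k \<ge> N \<Longrightarrow> step k \<le> 1" "\<And>k. k \<ge> N \<Longrightarrow> 1 \<le> len k"
    unfolding eventually_sequentially by auto
  \<comment> \<open>The bounds by 2 let rounding down lose at most half; those with 16 make the band
    fit into \<open>{1..n}\<close>; \<open>4 * E n \<le> L n\<close> gives \<open>R - m\<close> the
    size \<open>L n / 4\<close>; \<open>E n + 1 \<le> L n\<close> gives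
    \<open>R + m \<le> 2 * L n - 1\<close>.\<close>
  have ev: "eventually (\<lambda>n. 2 \<le> E n) sequentially" "eventually (\<lambda>n. 2 \<le> L n) sequentially"
    "eventually (\<lambda>n. 16 * L n \<le> real n) sequentially" "eventually (\<lambda>n. 16 * E n \<le> real n) sequentially"
    "eventually (\<lambda>n. 4 * E n \<le> L n) sequentially" "eventually (\<lambda>n. E n + 1 \<le> L n) sequentially"
    unfolding E_def L_def using alpha_gt alpha_lt pos by real_asymp+
  \<comment> \<open>Here 64 is 16 times 4 from counting rows and columns, \<open>1 / 288\<close> is
    half of \<open>(1/12)\<^sup>2\<close> from each entry, and the leading 2 undoes the halving in
    \<open>mse_coeff\<close>.\<close>
  have "eventually (\<lambda>n. real n powr (alpha - 1) * ln (real n) \<le> (2 * 64 * 288\<^sup>2 / rho) * mse_coeff n) sequentially"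
    using ev eventually_ge_at_top[of 16] eventually_ge_at_top[of "3 * N"]
  proof eventually_elim
    case (elim n)
    define m where "m = nat \<lfloor>E n\<rfloor>"
    define R where "R = nat \<lfloor>L n\<rfloor>"
    define h where "h = n div 2"
    have m: "E n / 2 \<le> real m" "real m \<le> E n" using elim unfolding m_def by linarith+
    have R: "L n / 2 \<le> real R" "real R \<le> L n" using elim unfolding R_def by linarith+
    have "16 * m \<le> n" "16 * R \<le> n" using m R elim by linarith+
    then have mR: "m \<le> n div 8" "R \<le> n div 4" by linarith+
    have hn: "real n / 3 \<le> real h" "h \<ge> 1" "h \<ge> N" using elim unfolding h_def by linarith+
    have n: "real n > 0" using elim by auto
    have three: "3 powr alpha \<le> 3" using alpha_lt powr_mono[of alpha 1 3] by simp
    have pw: "real n powr alpha / 3 \<le> (real n / 3) powr alpha"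
    proof -
      have "real n powr alpha / 3 \<le> real n powr alpha / 3 powr alpha"
        using three by (intro divide_left_mono) auto
      then show ?thesis by (simp add: powr_divide)
    qed
    have len: "R + m \<le> len k" if "k \<ge> h" for k
    proof -
      have k: "real n / 3 \<le> real k" using that hn by linarith
      have "ln 9 \<le> ln (real n)" using elim by simp
      moreover have "ln 9 = 2 * ln (3::real)" using ln_realpow[of 3 2] by simp
      ultimately have "ln (real n) / 2 \<le> ln (real n / 3)" using n by (simp add: ln_div)
      also have "\<dots> \<le> ln (real k)" using k n by simp
      finally have "(real n powr alpha / 3) * (ln (real n) / 2) \<le> real k powr alpha * ln (real k)"
        using k n alpha_gt elim by (intro mult_mono order_trans[OF pw] powr_mono2) auto
      then have "Ceta * ((real n powr alpha / 3) * (ln (real n) / 2)) \<le> Ceta * (real k powr alpha * ln (real k))"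
        using Ceta_pos by (intro mult_left_mono) auto
      then have "2 * L n \<le> Ceta * real k powr alpha * ln (real k)"
        by (simp add: L_def rho_def mult_ac)
      then have "2 * L n - 1 \<le> real (len k)" using len_ge[of k] by linarith
      then have "real R + real m \<le> real (len k)" using R m elim by linarith
      then show ?thesis by linarith
    qed
    have sth: "real m * step h \<le> 1 / 2"
    proof -
      have "real h powr (- alpha) \<le> (real n / 3) powr (- alpha)"
        using hn n alpha_gt by (intro powr_mono2') auto
      also have "\<dots> = 3 powr alpha * real n powr (- alpha)"
        using n by (simp add: powr_divide powr_minus_divide)
      also have "\<dots> \<le> 3 * real n powr (- alpha)"
        using three by (intro mult_right_mono) auto
      finally have "step h \<le> eta * (3 * real n powr (- alpha))"
        unfolding step_def using eta_pos by (intro mult_left_mono) auto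
      then have "real m * step h \<le> E n * (eta * (3 * real n powr (- alpha)))"
        using m step_nonneg elim by (intro mult_mono) auto
      also have "\<dots> = 1 / 2"
        using n eta_pos by (simp add: E_def eps_def powr_minus)
      finally show ?thesis .
    qed
    have "E n / 2 * step n \<le> real m * step n"
      using m step_nonneg by (intro mult_right_mono) auto
    moreover have "E n / 2 * step n = 1 / 12"
      using n eta_pos by (simp add: E_def eps_def step_def powr_minus)
    ultimately have ms: "1 / 12 \<le> real m * step n" by simp
    then have "(1 / 12)\<^sup>2 \<le> (real m * step n)\<^sup>2" by (intro power_mono) auto
    then have ms2: "1 / 288 / real n \<le> (real m * step n)\<^sup>2 / (2 * real n)"
      using n by (simp add: field_simps power2_eq_square)
    \<comment> \<open>The band leaves \<open>n div 4\<close> indices below for \<open>R\<close>, so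
      that \<open>q \<ge> h\<close>, and \<open>n div 8\<close> above for \<open>m\<close>, so that
      \<open>p + m \<le> n\<close>.\<close>
    define P where "P = {h + n div 4..<h + n div 4 + n div 8}"
    have Pn: "h + n div 4 + n div 8 + n div 8 \<le> n" unfolding h_def by linarith
    \<comment> \<open>Nonnegativity of the transposed entry prevents cancellation in the symmetrised
      matrix.\<close>
    have entry: "1 / 288 / real n \<le> qmat n p q \<and> 0 \<le> qmat n q p"
      if p: "p \<in> P" and q: "q \<in> {p - R..<p - m}" for p q
    proof -
      have "h + n div 4 \<le> p" "p < h + n div 4 + n div 8" "p \<le> q + R" "q < p - m"
        using p q by (auto simp: P_def)
      then have q': "h \<le> q" "q + m \<le> p" "p \<le> q + R" "p + m \<le> n" "N \<le> p" "N \<le> q"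
        using mR Pn hn(3) by linarith+
      have "(real m * step n)\<^sup>2 / (2 * real n) \<le> qmat n p q"
        by (rule qmat_ge[of h R m]) (use q' hn N len sth in auto)
      moreover have "0 \<le> qmat n q p"
        by (rule qmat_nonneg[of N]) (use q' N in auto)
      ultimately show ?thesis using ms2 by linarith
    qed
    have "real n / 16 * (L n / 4) * (1 / 288 / real n)\<^sup>2 \<le> real (n div 8) * real (R - m) * (1 / 288 / real n)\<^sup>2"
    proof (intro mult_right_mono mult_mono)
      show "real n / 16 \<le> real (n div 8)" using elim by linarith
      show "L n / 4 \<le> real (R - m)" using m R elim by linarith
    qed (use elim in auto)
    also have "\<dots> = (\<Sum>p\<in>P. \<Sum>q\<in>{p - R..<p - m}. (1 / 288 / real n)\<^sup>2)"
    proof -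
      have "card {p - R..<p - m} = R - m" if "p \<in> P" for p
        using that mR unfolding P_def by auto
      then show ?thesis by (simp add: P_def)
    qed
    also have "\<dots> \<le> (\<Sum>p\<in>P. \<Sum>q\<in>{p - R..<p - m}. (qmat n p q + qmat n q p)\<^sup>2)"
    proof (intro sum_mono power_mono)
      fix p q assume "p \<in> P" "q \<in> {p - R..<p - m}"
      from entry[OF this] show "1 / 288 / real n \<le> qmat n p q + qmat n q p" by linarith
    qed auto
    also have "\<dots> \<le> (\<Sum>p\<in>P. \<Sum>q=1..n. (qmat n p q + qmat n q p)\<^sup>2)"
    proof (intro sum_mono sum_mono2)
      fix p assume p: "p \<in> P"
      show "{p - R..<p - m} \<subseteq> {1..n}"
      proof
        fix q assume "q \<in> {p - R..<p - m}"
        then have "p \<le> q + R" "q < p" "h + n div 4 \<le> p" "p < h + n div 4 + n div 8"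
          using p by (auto simp: P_def)
        then have "1 \<le> q" "q \<le> n" using mR Pn hn(2) by linarith+
        then show "q \<in> {1..n}" by simp
      qed
    qed auto
    also have "\<dots> \<le> (\<Sum>p=1..n. \<Sum>q=1..n. (qmat n p q + qmat n q p)\<^sup>2)"
      using Pn hn by (intro sum_mono2 sum_nonneg) (auto simp: P_def)
    also have "\<dots> \<le> 2 * mse_coeff n"
      by (simp add: mse_coeff_def)
    finally have "real n / 16 * (L n / 4) * (1 / 288 / real n)\<^sup>2 \<le> 2 * mse_coeff n" .
    moreover have "real n / 16 * (L n / 4) * (1 / 288 / real n)\<^sup>2 = rho / (64 * 288\<^sup>2) * (real n powr (alpha - 1) * ln (real n))"
      using n by (simp add: L_def powr_diff power2_eq_square)
    ultimately show ?case using pos by (simp add: field_simps)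
  qed
  then show ?thesis by blast
qed

end

section \<open>Two-sided rate for the mean squared error\<close>

theorem theorem4p1:
  fixes M :: "'a measure" and e :: "nat \<Rightarrow> 'a \<Rightarrow> real"
    and \<sigma> \<eta> \<alpha> Ceta :: real
  assumes "prob_space M"
    and "\<sigma> > 0"
    and "prob_space.indep_vars M (\<lambda>_. borel) e {1..}"
    and "\<And>i. i \<ge> 1 \<Longrightarrow> distributed M lborel (e i) (normal_density 0 (sqrt \<sigma>))"
    and "\<eta> > 0" and "1/2 < \<alpha>" and "\<alpha> < 1"
    and "Ceta > 1 / \<eta>"
  shows "\<exists>c C. 0 < c \<and> c \<le> C \<and> (\<forall>n::nat. n \<ge> 2 \<longrightarrow>
           c * (real n powr (\<alpha> - 1) * ln (real n))
             \<le> prob_space.expectation M (\<lambda>\<omega>. (sigma_hat \<eta> \<alpha> Ceta (\<lambda>i. 0 + e i \<omega>) n - \<sigma>)\<^sup>2)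
         \<and> prob_space.expectation M (\<lambda>\<omega>. (sigma_hat \<eta> \<alpha> Ceta (\<lambda>i. 0 + e i \<omega>) n - \<sigma>)\<^sup>2)
             \<le> C * (real n powr (\<alpha> - 1) * ln (real n)))"
proof -
  interpret prob_space M by fact
  interpret sgd_batch_means \<eta> \<alpha> Ceta by unfold_locales (use assms in auto)
  define g where "g n = real n powr (\<alpha> - 1) * ln (real n)" for n
  \<comment> \<open>At \<open>n = 1\<close> the rate is 0 because \<open>ln 1 = 0\<close>, while the
    mean squared error is positive; hence the range starts at 2.\<close>
  have g_pos: "0 < g n" if "n \<ge> 2" for n using that by (simp add: g_def)
  have mse: "expectation (\<lambda>\<omega>. (sigma_hat \<eta> \<alpha> Ceta (\<lambda>i. 0 + e i \<omega>) n - \<sigma>)\<^sup>2) = \<sigma>\<^sup>2 * mse_coeff n" for n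
  proof -
    \<comment> \<open>\<open>normal_density\<close> takes a standard deviation, so the variance
      \<sigma> enters as its square root.\<close>
    have "(sqrt \<sigma>) ^ 4 = \<sigma>\<^sup>2"
      using \<open>\<sigma> > 0\<close> power_mult[of "sqrt \<sigma>" 2 2] by simp
    then show ?thesis
      using gaussian_quadratic_form_mse[OF assms(3), of "sqrt \<sigma>" "{1..n}" "qmat n"] assms(2,4)
      by (simp add: sigma_hat_eq mse_coeff_def)
  qed
  obtain C where C: "C > 0" "\<And>n. n \<ge> 2 \<Longrightarrow> mse_coeff n \<le> C * g n"
    using mse_coeff_le unfolding g_def by auto
  obtain c where "eventually (\<lambda>n. g n \<le> c * mse_coeff n) sequentially"
    using mse_coeff_ge unfolding g_def by auto
  from eventually_le_imp_uniform_le[OF this, of 2] mse_coeff_pos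
  obtain D where D: "D > 0" "\<And>n. n \<ge> 2 \<Longrightarrow> g n \<le> D * mse_coeff n" by auto
  have bounds: "\<sigma>\<^sup>2 / D * g n \<le> \<sigma>\<^sup>2 * mse_coeff n" "\<sigma>\<^sup>2 * mse_coeff n \<le> \<sigma>\<^sup>2 * C * g n" if "n \<ge> 2" for n
  proof -
    have "g n / D \<le> mse_coeff n" using D that by (simp add: field_simps)
    then have "\<sigma>\<^sup>2 * (g n / D) \<le> \<sigma>\<^sup>2 * mse_coeff n" by (intro mult_left_mono) auto
    then show "\<sigma>\<^sup>2 / D * g n \<le> \<sigma>\<^sup>2 * mse_coeff n" by simp
    have "\<sigma>\<^sup>2 * mse_coeff n \<le> \<sigma>\<^sup>2 * (C * g n)" using C that by (intro mult_left_mono) auto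
    then show "\<sigma>\<^sup>2 * mse_coeff n \<le> \<sigma>\<^sup>2 * C * g n" by (simp only: mult.assoc)
  qed
  \<comment> \<open>The order of the two constants follows by comparing both bounds at
    \<open>n = 2\<close>, where the rate is positive.\<close>
  have "\<sigma>\<^sup>2 / D * g 2 \<le> \<sigma>\<^sup>2 * C * g 2" using bounds[of 2] by linarith
  then have "\<sigma>\<^sup>2 / D \<le> \<sigma>\<^sup>2 * C" using g_pos[of 2] by (rule mult_right_le_imp_le) simp
  moreover have "0 < \<sigma>\<^sup>2 / D" using assms(2) D by simp
  ultimately show ?thesis
    unfolding mse g_def[symmetric] using bounds by blast
qed

end
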